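(* Suppose that there exists $\alpha>1$ such that $$a_i\le i^{-\alpha+o(1)}\qquad\text{and}\qquad a_i+a_{i+1}+\dots+a_{2i}=i^{1-\alpha+o(1)}\qquad\text{as } i\to\infty .$$ Then the set of leaves of the random tree $\mathcal T$ built by aggregation from the sequence $(a_i)_{i\ge1}$ is almost surely of Hausdorff dimension $\alpha^{-1}$.
   Context: Let $\mathbf a=(a_i)_{i\ge 1}$ be a (deterministic) sequence of positive real numbers. The random trees $(\mathcal T_n)_{n\ge1}$ are built as follows: $\mathcal T_1$ is a closed segment of length $a_1$, rooted at one of its ends $\rho$; recursively, conditionally on $\mathcal T_1,\dots,\mathcal T_n$, pick a point of $\mathcal T_n$ uniformly (according to the length measure on $\mathcal T_n$ normalized to be a probability) and obtain $\mathcal T_{n+1}$ by gluing one end of a new closed segment ("branch") of length $a_{n+1}$ at this point. Concretely, $\mathcal T_1=\{(x,0,0,\dots):x\in[0,a_1]\}\subset\ell^1(\mathbb R)$ and $\mathcal T_{n+1}=\mathcal T_n\cup\{(u_1,\dots,u_n,x,0,0,\dots):x\in[0,a_{n+1}]\}$ where $(u_1,\dots,u_n,0,\dots)$ is the uniform point of $\mathcal T_n$. The tree $\mathcal T$ is the completion (closure in $\ell^1(\mathbb R)$) of the increasing union $\bigcup_n\mathcal T_n$, endowed with its length metric. A leaf of $\mathcal T$ is a point $x$ such that $\mathcal T\setminus\{x\}$ stays connected. Notation: $x_i\le i^{\beta+o(1)}$ means that for every $\varepsilon>0$, $x_i\le i^{\beta+\varepsilon}$ for all $i$ large enough; $x_i=i^{\beta+o(1)}$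 means that for every $\varepsilon>0$, $i^{\beta-\varepsilon}\le x_i\le i^{\beta+\varepsilon}$ for all $i$ large enough. *)

theory Defs
  imports "HOL-Probability.Probability"
begin

section \<open>The space of absolutely summable real sequences\<close>

typedef ell1 = "{x :: nat \<Rightarrow> real. summable (\<lambda>i. \<bar>x i\<bar>)}"
  morphisms ell1_nth Abs_ell1
  by (rule exI[of _ "\<lambda>_. 0"]) simp

setup_lifting type_definition_ell1

lemma summable_abs_ell1_nth: "summable (\<lambda>i. \<bar>ell1_nth x i\<bar>)"
  using ell1_nth[of x] by simp

lemma summable_abs_add:
  fixes x y :: "nat \<Rightarrow> real"
  assumes "summable (\<lambda>i. \<bar>x i\<bar>)" and "summable (\<lambda>i. \<bar>y i\<bar>)"
  shows "summable (\<lambda>i. \<bar>x i + y i\<bar>)"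
  by (rule summable_comparison_test'[OF summable_add[OF assms], of 0])
     (simp add: abs_triangle_ineq)

lemma summable_abs_diff:
  fixes x y :: "nat \<Rightarrow> real"
  assumes "summable (\<lambda>i. \<bar>x i\<bar>)" and "summable (\<lambda>i. \<bar>y i\<bar>)"
  shows "summable (\<lambda>i. \<bar>x i - y i\<bar>)"
  by (rule summable_comparison_test'[OF summable_add[OF assms], of 0])
     (simp add: abs_triangle_ineq4)

instantiation ell1 :: real_vector
begin

lift_definition zero_ell1 :: ell1 is "\<lambda>_. 0"
  by simp

lift_definition plus_ell1 :: "ell1 \<Rightarrow> ell1 \<Rightarrow> ell1" is "\<lambda>x y i. x i + y i"
  by (rule summable_abs_add)

lift_definition minus_ell1 :: "ell1 \<Rightarrow> ell1 \<Rightarrow> ell1" is "\<lambda>x y i. x i - y i"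
  by (rule summable_abs_diff)

lift_definition uminus_ell1 :: "ell1 \<Rightarrow> ell1" is "\<lambda>x i. - x i"
  by simp

lift_definition scaleR_ell1 :: "real \<Rightarrow> ell1 \<Rightarrow> ell1" is "\<lambda>c x i. c * x i"
  by (simp add: abs_mult summable_mult)

instance
  by standard (transfer; simp add: fun_eq_iff algebra_simps)+

end

instantiation ell1 :: real_normed_vector
begin

lift_definition norm_ell1 :: "ell1 \<Rightarrow> real" is "\<lambda>x. \<Sum>i. \<bar>x i\<bar>" .

definition dist_ell1 :: "ell1 \<Rightarrow> ell1 \<Rightarrow> real"
  where "dist_ell1 x y = norm (x - y)"

definition sgn_ell1 :: "ell1 \<Rightarrow> ell1"
  where "sgn_ell1 x = x /\<^sub>R norm x"

definition uniformity_ell1 :: "(ell1 \<times> ell1) filter"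
  where "uniformity_ell1 = (INF e\<in>{0 <..}. principal {(x, y). dist x y < e})"

definition open_ell1 :: "ell1 set \<Rightarrow> bool"
  where "open_ell1 S = (\<forall>x\<in>S. \<forall>\<^sub>F (x', y) in uniformity. x' = x \<longrightarrow> y \<in> S)"

instance
proof
  fix x y :: ell1 and c :: real
  show "norm x = 0 \<longleftrightarrow> x = 0"
    by transfer (auto simp: suminf_eq_zero_iff)
  show "norm (x + y) \<le> norm x + norm y"
  proof transfer
    fix x y :: "nat \<Rightarrow> real"
    assume *: "summable (\<lambda>i. \<bar>x i\<bar>)" "summable (\<lambda>i. \<bar>y i\<bar>)"
    have "(\<Sum>i. \<bar>x i + y i\<bar>) \<le> (\<Sum>i. \<bar>x i\<bar> + \<bar>y i\<bar>)"
      by (intro suminf_le summable_abs_add summable_add * abs_triangle_ineq)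
    also have "\<dots> = (\<Sum>i. \<bar>x i\<bar>) + (\<Sum>i. \<bar>y i\<bar>)"
      by (rule suminf_add[symmetric]) (fact *)+
    finally show "(\<Sum>i. \<bar>x i + y i\<bar>) \<le> (\<Sum>i. \<bar>x i\<bar>) + (\<Sum>i. \<bar>y i\<bar>)" .
  qed
  show "norm (c *\<^sub>R x) = \<bar>c\<bar> * norm x"
    by transfer (simp add: abs_mult suminf_mult)
qed (rule dist_ell1_def sgn_ell1_def uniformity_ell1_def open_ell1_def)+

end

lift_definition unit_ell1 :: "nat \<Rightarrow> ell1" is "\<lambda>k i. if i = k then 1 else 0"
  subgoal for k by (rule summable_finite[of "{k}"]) auto
  done


section \<open>Length metric of a subset of a metric space\<close>

definition path_length :: "(real \<Rightarrow> 'a::metric_space) \<Rightarrow> ennreal"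
  where "path_length g =
    (SUP ts\<in>{ts. sorted ts \<and> set ts \<subseteq> {0..1}}.
      \<Sum>i<length ts - 1. ennreal (dist (g (ts ! i)) (g (ts ! Suc i))))"

text \<open>The infimum is \<open>\<infinity>\<close>, which is sent to \<open>0\<close>, when no rectifiable path in \<open>X\<close> joins
  \<open>x\<close> and \<open>y\<close>.\<close>

definition length_dist :: "'a::metric_space set \<Rightarrow> 'a \<Rightarrow> 'a \<Rightarrow> real"
  where "length_dist X x y = enn2real
    (INF g\<in>{g. path g \<and> path_image g \<subseteq> X \<and> pathstart g = x \<and> pathfinish g = y}. path_length g)"


section \<open>Hausdorff dimension in a metric space with carrier \<open>X\<close> and distance \<open>d\<close>\<close>

definition metric_diameter :: "('a \<Rightarrow> 'a \<Rightarrow> real) \<Rightarrow> 'a set \<Rightarrow> ennreal"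
  where "metric_diameter d S = (SUP (x, y)\<in>S \<times> S. ennreal (d x y))"

definition hausdorff_premeasure ::
    "'a set \<Rightarrow> ('a \<Rightarrow> 'a \<Rightarrow> real) \<Rightarrow> real \<Rightarrow> real \<Rightarrow> 'a set \<Rightarrow> ennreal"
  where "hausdorff_premeasure X d s \<delta> S =
    (INF C\<in>{C :: nat \<Rightarrow> 'a set. S \<subseteq> (\<Union>i. C i) \<and>
              (\<forall>i. C i \<subseteq> X \<and> metric_diameter d (C i) \<le> ennreal \<delta>)}.
      \<Sum>i. ennreal (enn2real (metric_diameter d (C i)) powr s))"

definition hausdorff_measure ::
    "'a set \<Rightarrow> ('a \<Rightarrow> 'a \<Rightarrow> real) \<Rightarrow> real \<Rightarrow> 'a set \<Rightarrow> ennreal"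
  where "hausdorff_measure X d s S = (SUP \<delta>\<in>{0<..}. hausdorff_premeasure X d s \<delta> S)"

text \<open>The exponent \<open>0\<close> is left out because \<open>0 powr 0 = 0\<close>; this does not change the infimum.\<close>

definition hausdorff_dim :: "'a set \<Rightarrow> ('a \<Rightarrow> 'a \<Rightarrow> real) \<Rightarrow> 'a set \<Rightarrow> ereal"
  where "hausdorff_dim X d S = Inf (ereal ` {s. 0 < s \<and> hausdorff_measure X d s S = 0})"


section \<open>Trees built by aggregation\<close>

text \<open>Branches are numbered from \<open>1\<close>, and \<open>u n\<close> (for \<open>n \<ge> 1\<close>) is the point of the \<open>n\<close>-th tree at
  which branch \<open>n + 1\<close> is glued; \<open>u 0\<close> is not used. Coordinates in \<open>ell1\<close> are numbered from \<open>0\<close>,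
  so branch \<open>i\<close> runs along coordinate \<open>i - 1\<close>, which vanishes on the trees with fewer than \<open>i\<close>
  branches. The root is \<open>0\<close>.\<close>

definition branch_point :: "(nat \<Rightarrow> ell1) \<Rightarrow> nat \<Rightarrow> real \<Rightarrow> ell1"
  where "branch_point u i x = (if i = 1 then 0 else u (i - 1)) + x *\<^sub>R unit_ell1 (i - 1)"

definition finite_tree :: "(nat \<Rightarrow> real) \<Rightarrow> (nat \<Rightarrow> ell1) \<Rightarrow> nat \<Rightarrow> ell1 set"
  where "finite_tree a u n = (\<Union>i\<in>{1..n}. branch_point u i ` {0..a i})"

definition tree_length_measure :: "(nat \<Rightarrow> real) \<Rightarrow> (nat \<Rightarrow> ell1) \<Rightarrow> nat \<Rightarrow> ell1 measure"
  where "tree_length_measure a u n = measure_of UNIV (sets borel)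
    (\<lambda>B. \<Sum>i=1..n. emeasure lborel {x\<in>{0..a i}. branch_point u i x \<in> B})"

definition tree_uniform :: "(nat \<Rightarrow> real) \<Rightarrow> (nat \<Rightarrow> ell1) \<Rightarrow> nat \<Rightarrow> ell1 measure"
  where "tree_uniform a u n = uniform_measure (tree_length_measure a u n) (finite_tree a u n)"

definition limit_tree :: "(nat \<Rightarrow> real) \<Rightarrow> (nat \<Rightarrow> ell1) \<Rightarrow> ell1 set"
  where "limit_tree a u = closure (\<Union>n\<in>{1..}. finite_tree a u n)"

definition leaves :: "'a::metric_space set \<Rightarrow> 'a set"
  where "leaves T =
    {x\<in>T. connectedin (Metric_space.mtopology T (length_dist T)) (T - {x})}"

text \<open>The first \<open>n\<close> trees and the points \<open>U 1, \<dots>, U (n - 1)\<close> determine each other, so conditioning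
  on the former is conditioning on the latter.\<close>

definition glue_history :: "'w measure \<Rightarrow> (nat \<Rightarrow> 'w \<Rightarrow> ell1) \<Rightarrow> nat \<Rightarrow> 'w measure"
  where "glue_history M U n =
    sigma (space M) {U k -` B \<inter> space M |k B. 1 \<le> k \<and> k < n \<and> B \<in> sets borel}"

locale tree_aggregation = prob_space M
  for M :: "'w measure" and a :: "nat \<Rightarrow> real" and U :: "nat \<Rightarrow> 'w \<Rightarrow> ell1" +
  assumes measurable_glue_point: "1 \<le> n \<Longrightarrow> U n \<in> borel_measurable M"
    and uniform_glue_point: "1 \<le> n \<Longrightarrow> B \<in> sets borel \<Longrightarrow>
      AE \<omega> in M. real_cond_exp M (glue_history M U n) (\<lambda>\<omega>. indicator B (U n \<omega>)) \<omega> =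
        measure (tree_uniform a (\<lambda>k. U k \<omega>) n) B"


section \<open>Asymptotic notation\<close>

text \<open>\<open>x i \<le> i\<^bsup>\<beta>+o(1)\<^esup>\<close> and \<open>x i = i\<^bsup>\<beta>+o(1)\<^esup>\<close> as \<open>i \<rightarrow> \<infinity>\<close>.\<close>

definition le_powr_o1 :: "(nat \<Rightarrow> real) \<Rightarrow> real \<Rightarrow> bool"
  where "le_powr_o1 x \<beta> \<longleftrightarrow>
    (\<forall>\<epsilon>>0. \<forall>\<^sub>F i in sequentially. x i \<le> real i powr (\<beta> + \<epsilon>))"

definition eq_powr_o1 :: "(nat \<Rightarrow> real) \<Rightarrow> real \<Rightarrow> bool"
  where "eq_powr_o1 x \<beta> \<longleftrightarrow>
    (\<forall>\<epsilon>>0. \<forall>\<^sub>F i in sequentially. real i powr (\<beta> - \<epsilon>) \<le> x i \<and> x i \<le> real i powr (\<beta> + \<epsilon>))"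

end

theory Submission
  imports Defs "HOL-Real_Asymp.Real_Asymp"
begin

text \<open>
  In the sequence space, a point of the tree records how far the path from the root to it travels along
  each branch. This gives a description of the whole tree by coordinates (\<open>tree_points\<close>,
  \<open>limit_tree_eq_tree_points\<close>), valid as soon as every gluing point lies in the tree built before it, which
  is almost surely the case. Two points of the tree are joined inside it by a path as long as their
  distance in the sequence space, so the length metric is the restriction of the norm metric
  (\<open>length_dist_tree_points\<close>). Inner points of branches are not leaves, while every point outside the finite
  trees is one. Up to countably many points (the root and ends of branches), the leaves are thus the points with
  infinitely many nonzero coordinates.

  Upper bound. Let \<open>1 < \<beta> < \<alpha>\<close>. A branch with index in \<open>[n, 2 n)\<close> is glued on a given branch of that block with
  probability at most a constant times \<open>n powr - \<beta>\<close>. Hence a chain of \<open>k\<close> branches of the block, each glued on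
  the preceding one, exists with probability at most a constant times
  \<open>n ^ k * n powr (- \<beta> * (k - 1))\<close>, which is summable for large \<open>k\<close>. So almost surely no path uses more than \<open>k\<close>
  branches of a block with large \<open>n\<close>, and summing over the blocks, the part of the tree that is reached
  through branch \<open>c + 1\<close> has diameter of order at most \<open>c powr - \<beta>\<close>. A leaf with infinite
  support lies in such parts for arbitrarily large \<open>c\<close>, and these parts form covers showing that the
  \<open>s\<close>-dimensional measure of the leaves vanishes when \<open>\<beta> * s > 1\<close> (\<open>hausdorff_measure_leaves_eq_0\<close>).

  Lower bound. Let \<open>s < 1 / \<alpha>\<close>. The hypothesis on the block sums forces \<open>n powr (1 - o(1))\<close> of the branches between
  \<open>n\<close> and \<open>2 n\<close> to have length \<open>n powr (- \<alpha> - o(1))\<close>. Take blocks at rapidly growing positions \<open>N k\<close>, and cut each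
  long branch of block \<open>k\<close> into cells of width slightly larger than \<open>1 / N (k + 1)\<close>. Almost surely, from some \<open>k\<close>
  on, each cell receives a long branch of block \<open>k + 1\<close> in its upper half. Following these
  branches gives a Cantor set of leaves, indexed by expansions of real numbers in a mixed radix system, and
  the index is a Hoelder function of the leaf with exponent \<open>s\<close> (\<open>cantor_leaves\<close>). Lebesgue
  measure on the indices then bounds the \<open>s\<close>-dimensional measure of the leaves away from \<open>0\<close>
  (\<open>hausdorff_measure_neq_0\<close>).

  The probabilistic input is small: conditionally on the past, the next gluing point falls on a given piece of a
  branch with probability its length divided by the total length, whatever the shape of the tree, so that bounds for
  several gluing points multiply (\<open>prob_glue_points_le\<close>).
\<close>

section \<open>Coordinates in the sequence space\<close>

lemmas ell1_nth_simps [simp] =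
  zero_ell1.rep_eq plus_ell1.rep_eq minus_ell1.rep_eq scaleR_ell1.rep_eq unit_ell1.rep_eq

lemma ell1_eqI: "(\<And>i. ell1_nth x i = ell1_nth y i) \<Longrightarrow> x = y"
  by (simp add: ell1_nth_inject[symmetric] fun_eq_iff)

lemma abs_ell1_nth_le_norm: "\<bar>ell1_nth x i\<bar> \<le> norm x"
  unfolding norm_ell1.rep_eq
  using sum_le_suminf[OF summable_abs_ell1_nth, of "{i}" x] by simp

lemma abs_ell1_nth_diff_le_dist: "\<bar>ell1_nth x i - ell1_nth y i\<bar> \<le> dist x y"
  using abs_ell1_nth_le_norm[of "x - y" i] by (simp add: dist_norm)

lemma norm_ell1_le:
  assumes "\<And>n. (\<Sum>i<n. \<bar>ell1_nth x i\<bar>) \<le> r"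
  shows "norm x \<le> r"
  unfolding norm_ell1.rep_eq using summable_abs_ell1_nth assms by (intro suminf_le_const) auto

lemma continuous_on_ell1_nth [continuous_intros]:
  "continuous_on S f \<Longrightarrow> continuous_on S (\<lambda>x. ell1_nth (f x) i)"
proof (rule continuous_on_compose2[of UNIV "\<lambda>x. ell1_nth x i" S f])
  show "continuous_on UNIV (\<lambda>x. ell1_nth x i)"
    unfolding continuous_on_iff
    by (metis abs_ell1_nth_diff_le_dist dist_real_def order_le_less_trans)
qed auto

lemma measurable_ell1_nth [measurable]: "(\<lambda>x. ell1_nth x i) \<in> borel_measurable borel"
  by (intro borel_measurable_continuous_onI continuous_intros)

lemma tendsto_ell1_nth: "(f \<longlongrightarrow> x) F \<Longrightarrow> ((\<lambda>n. ell1_nth (f n) i) \<longlongrightarrow> ell1_nth x i) F"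
  using continuous_on_ell1_nth[of UNIV "\<lambda>x. x" i]
  by (auto simp: continuous_on_eq_continuous_at intro: isCont_tendsto_compose)

lift_definition ell1_take :: "nat \<Rightarrow> ell1 \<Rightarrow> ell1" is "\<lambda>n x i. if i < n then x i else 0"
  subgoal for n x by (rule summable_comparison_test'[of "\<lambda>i. \<bar>x i\<bar>" 0]) auto
  done

declare ell1_take.rep_eq [simp]

lemma ell1_take_tendsto: "(\<lambda>n. ell1_take n x) \<longlonglongrightarrow> x"
proof -
  have "norm (ell1_take n x - x) = (\<Sum>i. \<bar>ell1_nth x (i + n)\<bar>)" for n
  proof -
    have "(\<Sum>i. \<bar>ell1_nth (ell1_take n x - x) i\<bar>)
      = (\<Sum>i. \<bar>ell1_nth (ell1_take n x - x) (i + n)\<bar>) + (\<Sum>i<n. \<bar>ell1_nth (ell1_take n x - x) i\<bar>)"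
      by (rule suminf_split_initial_segment[OF summable_abs_ell1_nth])
    then show ?thesis by (simp add: norm_ell1.rep_eq)
  qed
  moreover have "(\<lambda>n. \<Sum>i. \<bar>ell1_nth x (i + n)\<bar>) \<longlonglongrightarrow> 0"
    using suminf_exist_split2[OF summable_abs_ell1_nth[of x]] by simp
  ultimately show ?thesis
    by (subst LIM_zero_iff[symmetric], subst tendsto_norm_zero_iff[symmetric]) simp
qed

text \<open>For a point with nonnegative coordinates, filling the coordinates one after the other, up to
  total mass \<open>t\<close>, runs along the path from \<open>0\<close> to that point.\<close>

lift_definition ell1_clip :: "ell1 \<Rightarrow> real \<Rightarrow> ell1"
  is "\<lambda>x t i. min t (sum x {..<Suc i}) - min t (sum x {..<i})"
  subgoal for x t by (rule summable_comparison_test'[of "\<lambda>i. \<bar>x i\<bar>" 0]) auto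
  done

declare ell1_clip.rep_eq [simp]

definition ell1_nonneg :: "ell1 \<Rightarrow> bool"
  where "ell1_nonneg x \<longleftrightarrow> (\<forall>i. 0 \<le> ell1_nth x i)"

lemma ell1_nonneg_nth: "ell1_nonneg x \<Longrightarrow> 0 \<le> ell1_nth x i"
  by (simp add: ell1_nonneg_def)

lemma norm_ell1_nonneg: "ell1_nonneg x \<Longrightarrow> norm x = (\<Sum>i. ell1_nth x i)"
  by (simp add: norm_ell1.rep_eq ell1_nonneg_def)

lemma summable_ell1_nth: "summable (ell1_nth x)"
  using summable_abs_ell1_nth by (rule summable_rabs_cancel)

lemma sum_ell1_nth_le_norm: "(\<Sum>i<n. ell1_nth x i) \<le> norm x"
proof -
  have "(\<Sum>i<n. ell1_nth x i) \<le> (\<Sum>i<n. \<bar>ell1_nth x i\<bar>)"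
    by (intro sum_mono) simp
  also have "\<dots> \<le> norm x"
    unfolding norm_ell1.rep_eq by (intro sum_le_suminf summable_abs_ell1_nth) auto
  finally show ?thesis .
qed

lemma sum_ell1_nth_mono:
  "ell1_nonneg x \<Longrightarrow> m \<le> n \<Longrightarrow> (\<Sum>i<m. ell1_nth x i) \<le> (\<Sum>i<n. ell1_nth x i)"
  by (rule sum_mono2) (auto simp: ell1_nonneg_def)

lemma ell1_clip_zero: "ell1_nonneg x \<Longrightarrow> ell1_clip x 0 = 0"
  by (rule ell1_eqI) (simp add: sum_nonneg ell1_nonneg_nth min_def)

lemma ell1_clip_full:
  assumes "norm x \<le> t"
  shows "ell1_clip x t = x"
proof (rule ell1_eqI)
  fix i
  show "ell1_nth (ell1_clip x t) i = ell1_nth x i"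
    using sum_ell1_nth_le_norm[of x i] sum_ell1_nth_le_norm[of x "Suc i"] assms
    by (simp add: min_def)
qed

lemma dist_ell1_clip:
  assumes "ell1_nonneg x"
  shows "dist (ell1_clip x s) (ell1_clip x t) \<le> \<bar>s - t\<bar>"
proof -
  have "dist (ell1_clip x s) (ell1_clip x t) \<le> t - s" if "s \<le> t" "0 \<le> t" for s t
  proof -
    define P where "P n = (\<Sum>i<n. ell1_nth x i)" for n
    have P: "P i \<le> P (Suc i)" for i
      using sum_ell1_nth_mono[OF assms, of i "Suc i"] by (simp add: P_def)
    have "P 0 = 0" by (simp add: P_def)
    have "norm (ell1_clip x t - ell1_clip x s) \<le> t - s"
    proof (rule norm_ell1_le)
      fix n
      define D where "D i = (min t (P (Suc i)) - min s (P (Suc i))) - (min t (P i) - min s (P i))" for i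
      have nth: "ell1_nth (ell1_clip x t - ell1_clip x s) i = D i" for i
        by (simp add: P_def D_def)
      have "0 \<le> D i" for i
        using P[of i] that unfolding D_def by (auto simp: min_def)
      then have "(\<Sum>i<n. \<bar>ell1_nth (ell1_clip x t - ell1_clip x s) i\<bar>) = (\<Sum>i<n. D i)"
        by (simp only: nth abs_of_nonneg)
      also have "\<dots> = (min t (P n) - min s (P n)) - (min t (P 0) - min s (P 0))"
        unfolding D_def by (rule sum_lessThan_telescope)
      also have "\<dots> \<le> t - s"
        using that \<open>P 0 = 0\<close> by (auto simp: min_def)
      finally show "(\<Sum>i<n. \<bar>ell1_nth (ell1_clip x t - ell1_clip x s) i\<bar>) \<le> t - s" .
    qed
    then show ?thesis by (simp add: dist_norm norm_minus_commute)
  qed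
  moreover have "dist (ell1_clip x s) (ell1_clip x t) = 0" if "s \<le> t" "t \<le> 0" for s t
  proof -
    have "min r (\<Sum>i<n. ell1_nth x i) = r" if "r \<le> 0" for r n
      using that sum_nonneg[of "{..<n}" "ell1_nth x"] ell1_nonneg_nth[OF assms] by auto
    then have "ell1_clip x s = ell1_clip x t"
      using that by (intro ell1_eqI) (simp del: sum.lessThan_Suc)
    then show ?thesis by simp
  qed
  ultimately have le: "dist (ell1_clip x s) (ell1_clip x t) \<le> t - s" if "s \<le> t" for s t
    using that by (metis diff_ge_0_iff_ge linorder_linear)
  show ?thesis
    using le[of s t] le[of t s] by (cases "s \<le> t") (auto simp: dist_commute abs_if)
qed

lemma continuous_on_ell1_clip: "ell1_nonneg x \<Longrightarrow> continuous_on S (ell1_clip x)"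
  unfolding continuous_on_iff
  by (metis dist_ell1_clip dist_real_def order_le_less_trans)

text \<open>Here \<open>h\<close> is the mass of the common part: the paths from \<open>0\<close> to the two points coincide up to \<open>h\<close>,
  and as the supports are disjoint afterwards, the remaining parts contribute to the distance without
  cancellation. So the path through the separation point is as short as the norm allows.\<close>

lemma dist_disjoint_after:
  assumes x: "ell1_nonneg x" and y: "ell1_nonneg y"
    and eq: "\<And>i. i < k \<Longrightarrow> ell1_nth x i = ell1_nth y i"
    and less: "ell1_nth x k < ell1_nth y k"
    and disj: "\<And>i. i > k \<Longrightarrow> ell1_nth x i = 0 \<or> ell1_nth y i = 0"
  defines "h \<equiv> \<Sum>i<Suc k. ell1_nth x i"
  shows "dist x y = (norm x - h) + (norm y - h)"
    and "ell1_clip x h = ell1_clip y h"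
    and "0 \<le> h" and "h \<le> norm x" and "h \<le> norm y"
proof -
  define m where "m i = (if i \<le> k then ell1_nth x i else 0)" for i
  have m: "m sums h"
    unfolding m_def h_def using sums_If_finite_set[of "{..<Suc k}" "ell1_nth x"]
    by (simp add: less_Suc_eq_le)
  have "(\<lambda>i. (ell1_nth x i + ell1_nth y i) - 2 * m i) sums ((norm x + norm y) - 2 * h)"
    unfolding norm_ell1_nonneg[OF x] norm_ell1_nonneg[OF y]
    by (intro sums_diff sums_add summable_sums summable_ell1_nth sums_mult m)
  moreover have "(ell1_nth x i + ell1_nth y i) - 2 * m i = \<bar>ell1_nth (x - y) i\<bar>" for i
    using eq[of i] less disj[of i] ell1_nonneg_nth[OF x, of i] ell1_nonneg_nth[OF y, of i]
    by (cases i k rule: linorder_cases) (auto simp: m_def)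
  ultimately have "(\<lambda>i. \<bar>ell1_nth (x - y) i\<bar>) sums ((norm x + norm y) - 2 * h)"
    by simp
  then show "dist x y = (norm x - h) + (norm y - h)"
    by (simp add: dist_norm norm_ell1.rep_eq sums_iff)
  show "0 \<le> h" unfolding h_def by (intro sum_nonneg ell1_nonneg_nth x)
  show "h \<le> norm x" unfolding h_def by (rule sum_ell1_nth_le_norm)
  have px: "(\<Sum>i<n. ell1_nth y i) = (\<Sum>i<n. ell1_nth x i)" if "n \<le> k" for n
    using that eq by (intro sum.cong) auto
  have hy: "h \<le> (\<Sum>i<Suc k. ell1_nth y i)"
    unfolding h_def using px[of k] less by simp
  then show "h \<le> norm y" using sum_ell1_nth_le_norm[of y "Suc k"] by simp
  have "min h (\<Sum>i<n. ell1_nth x i) = min h (\<Sum>i<n. ell1_nth y i)" for n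
  proof (cases "n \<le> k")
    case False
    then have "h \<le> (\<Sum>i<n. ell1_nth x i)" "h \<le> (\<Sum>i<n. ell1_nth y i)"
      using hy sum_ell1_nth_mono[OF x, of "Suc k" n] sum_ell1_nth_mono[OF y, of "Suc k" n]
      by (auto simp: h_def)
    then show ?thesis by simp
  qed (simp add: px)
  then show "ell1_clip x h = ell1_clip y h"
    by (intro ell1_eqI) (simp del: sum.lessThan_Suc)
qed

section \<open>Lipschitz paths and the length metric\<close>

lemma sum_dist_sorted_le:
  fixes g :: "real \<Rightarrow> 'a::metric_space"
  assumes lip: "\<And>s t. 0 \<le> s \<Longrightarrow> s \<le> t \<Longrightarrow> t \<le> 1 \<Longrightarrow> dist (g s) (g t) \<le> L * (t - s)"
    and "sorted ts" and "set ts \<subseteq> {0..1}" and "n < length ts"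
  shows "(\<Sum>i<n. dist (g (ts ! i)) (g (ts ! Suc i))) \<le> L * (ts ! n - ts ! 0)"
  using \<open>n < length ts\<close>
proof (induction n)
  case (Suc n)
  have "ts ! n \<in> {0..1}" "ts ! Suc n \<in> {0..1}"
    using Suc.prems assms(3) nth_mem[of n ts] nth_mem[of "Suc n" ts] by fastforce+
  moreover have "ts ! n \<le> ts ! Suc n"
    using Suc.prems assms(2) by (simp add: sorted_nth_mono)
  ultimately have "dist (g (ts ! n)) (g (ts ! Suc n)) \<le> L * (ts ! Suc n - ts ! n)"
    by (intro lip) auto
  then show ?case using Suc by (simp add: algebra_simps)
qed auto

lemma path_length_le_Lipschitz:
  fixes g :: "real \<Rightarrow> 'a::metric_space"
  assumes "0 \<le> L"
    and lip: "\<And>s t. 0 \<le> s \<Longrightarrow> s \<le> t \<Longrightarrow> t \<le> 1 \<Longrightarrow> dist (g s) (g t) \<le> L * (t - s)"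
  shows "path_length g \<le> ennreal L"
  unfolding path_length_def
proof (rule SUP_least)
  fix ts :: "real list" assume "ts \<in> {ts. sorted ts \<and> set ts \<subseteq> {0..1}}"
  then have ts: "sorted ts" "set ts \<subseteq> {0..1}" by auto
  show "(\<Sum>i<length ts - 1. ennreal (dist (g (ts ! i)) (g (ts ! Suc i)))) \<le> ennreal L"
  proof (cases "ts = []")
    case False
    then have n: "length ts - 1 < length ts" by simp
    have "ts ! (length ts - 1) \<in> {0..1}" "ts ! 0 \<in> {0..1}"
      using False ts(2) nth_mem[of "length ts - 1" ts] nth_mem[of 0 ts] by fastforce+
    then have "L * (ts ! (length ts - 1) - ts ! 0) \<le> L * 1"
      using \<open>0 \<le> L\<close> by (intro mult_left_mono) auto
    then have "(\<Sum>i<length ts - 1. dist (g (ts ! i)) (g (ts ! Suc i))) \<le> L"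
      using sum_dist_sorted_le[of g L, OF lip ts n] by simp
    then show ?thesis by (simp add: sum_ennreal ennreal_leI)
  qed simp
qed

lemma dist_le_path_length: "ennreal (dist (pathstart g) (pathfinish g)) \<le> path_length g"
proof -
  have "(\<Sum>i<length [0, 1::real] - 1. ennreal (dist (g ([0, 1] ! i)) (g ([0, 1] ! Suc i))))
    \<le> path_length g"
    unfolding path_length_def by (rule SUP_upper) auto
  then show ?thesis by (simp add: pathstart_def pathfinish_def)
qed

text \<open>No path is shorter than the distance of its ends, so a Lipschitz path with that constant is a
  shortest one.\<close>

lemma length_dist_eq_dist:
  fixes X :: "'a::metric_space set"
  assumes "\<And>s t. 0 \<le> s \<Longrightarrow> s \<le> t \<Longrightarrow> t \<le> 1 \<Longrightarrow> dist (g s) (g t) \<le> dist x y * (t - s)"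
    and "g ` {0..1} \<subseteq> X" and "g 0 = x" and "g 1 = y"
  shows "length_dist X x y = dist x y"
proof -
  have "continuous_on {0..1} g"
    unfolding continuous_on_iff
  proof safe
    fix s e :: real assume s: "s \<in> {0..1}" and e: "0 < e"
    have "dist (g t) (g s) \<le> dist x y * \<bar>t - s\<bar>" if "t \<in> {0..1}" for t
      using assms(1)[of s t] assms(1)[of t s] s that
      by (cases "s \<le> t") (auto simp: dist_commute abs_if)
    moreover have "dist x y * \<bar>t - s\<bar> < e" if "dist t s < e / (dist x y + 1)" for t
    proof -
      have "(dist x y + 1) * \<bar>t - s\<bar> < e"
        using that by (simp add: dist_real_def pos_less_divide_eq add_nonneg_pos mult.commute)
      then show ?thesis by (simp add: algebra_simps)
    qed
    ultimately have "dist (g t) (g s) < e" if "t \<in> {0..1}" "dist t s < e / (dist x y + 1)" for t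
      using that by (meson order_le_less_trans)
    moreover have "0 < e / (dist x y + 1)"
      using e by (simp add: add_nonneg_pos)
    ultimately show "\<exists>d>0. \<forall>t\<in>{0..1}. dist t s < d \<longrightarrow> dist (g t) (g s) < e"
      by blast
  qed
  then have g: "g \<in> {g. path g \<and> path_image g \<subseteq> X \<and> pathstart g = x \<and> pathfinish g = y}"
    using assms by (simp add: path_def path_image_def pathstart_def pathfinish_def)
  have "(INF g\<in>{g. path g \<and> path_image g \<subseteq> X \<and> pathstart g = x \<and> pathfinish g = y}. path_length g)
    = ennreal (dist x y)"
  proof (rule antisym)
    show "(INF g\<in>{g. path g \<and> path_image g \<subseteq> X \<and> pathstart g = x \<and> pathfinish g = y}. path_length g)
      \<le> ennreal (dist x y)"
      using path_length_le_Lipschitz[of "dist x y" g] assms(1) by (intro INF_lower2[OF g]) auto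
    show "ennreal (dist x y) \<le>
      (INF g\<in>{g. path g \<and> path_image g \<subseteq> X \<and> pathstart g = x \<and> pathfinish g = y}. path_length g)"
      using dist_le_path_length by (intro INF_greatest) auto
  qed
  then show ?thesis by (simp add: length_dist_def)
qed

lemma length_dist_outside: "x \<notin> X \<or> y \<notin> X \<Longrightarrow> length_dist X x y = 0"
proof -
  assume "x \<notin> X \<or> y \<notin> X"
  then have none: "{g. path g \<and> path_image g \<subseteq> X \<and> pathstart g = x \<and> pathfinish g = y} = {}"
    using pathstart_in_path_image pathfinish_in_path_image by blast
  show ?thesis unfolding length_dist_def none by simp
qed

text \<open>The length metric then induces the subspace topology, and connectedness has its usual meaning.\<close>

lemma leaves_eq_connected:
  fixes T :: "'a::metric_space set"
  assumes "\<And>x y. x \<in> T \<Longrightarrow> y \<in> T \<Longrightarrow> length_dist T x y = dist x y"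
  shows "leaves T = {x \<in> T. connected (T - {x})}"
proof -
  have dist: "length_dist T x y = (if x \<in> T \<and> y \<in> T then dist x y else 0)" for x y
    using assms[of x y] length_dist_outside[of x T y] by auto
  interpret L: Metric_space T "length_dist T"
    by standard (auto simp: dist dist_commute dist_triangle)
  interpret S: Submetric UNIV "dist :: 'a \<Rightarrow> 'a \<Rightarrow> real" T
    by standard auto
  have "L.mball x r = S.sub.mball x r" for x r
    by (auto simp: dist)
  then have "L.mopen = S.sub.mopen"
    by (intro ext) (simp add: L.mopen_def S.sub.mopen_def)
  then have "L.mtopology = S.sub.mtopology"
    by (simp add: L.mtopology_def S.sub.mtopology_def)
  then have "L.mtopology = subtopology euclidean T"
    by (simp add: S.mtopology_submetric)
  then show ?thesis
    by (auto simp: leaves_def connectedin_subtopology)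
qed

section \<open>The tree in coordinates\<close>

text \<open>Coordinate \<open>j\<close> of a point is the distance that the path from the root to it travels along branch
  \<open>j + 1\<close>. If it is nonzero, the path passes through the starting point \<open>g j\<close> of that branch, which
  fixes all earlier coordinates. These conditions describe the whole tree without reference to its
  recursive construction, including the points added by the closure.\<close>

definition tree_points :: "(nat \<Rightarrow> real) \<Rightarrow> (nat \<Rightarrow> ell1) \<Rightarrow> ell1 set"
  where "tree_points l g =
    {x. \<forall>j. 0 \<le> ell1_nth x j \<and> ell1_nth x j \<le> l j \<and>
      (ell1_nth x j \<noteq> 0 \<longrightarrow> (\<forall>i<j. ell1_nth x i = ell1_nth (g j) i))}"

definition tree_points_upto :: "(nat \<Rightarrow> real) \<Rightarrow> (nat \<Rightarrow> ell1) \<Rightarrow> nat \<Rightarrow> ell1 set"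
  where "tree_points_upto l g n = {x \<in> tree_points l g. \<forall>j\<ge>n. ell1_nth x j = 0}"

lemma tree_points_nonneg: "x \<in> tree_points l g \<Longrightarrow> ell1_nonneg x"
  by (simp add: tree_points_def ell1_nonneg_def)

lemma tree_points_le: "x \<in> tree_points l g \<Longrightarrow> ell1_nth x j \<le> l j"
  by (simp add: tree_points_def)

lemma tree_points_prefix:
  "x \<in> tree_points l g \<Longrightarrow> ell1_nth x j \<noteq> 0 \<Longrightarrow> i < j \<Longrightarrow> ell1_nth x i = ell1_nth (g j) i"
  by (simp add: tree_points_def)

lemma tree_points_upto_subset: "tree_points_upto l g n \<subseteq> tree_points l g"
  by (auto simp: tree_points_upto_def)

lemma closed_tree_points: "closed (tree_points l g)"
  unfolding closed_sequential_limits
proof safe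
  fix f x assume f: "\<forall>n. f n \<in> tree_points l g" and lim: "f \<longlonglongrightarrow> x"
  note nth = tendsto_ell1_nth[OF lim]
  show "x \<in> tree_points l g"
    unfolding tree_points_def
  proof (intro CollectI allI conjI impI)
    fix j
    show "0 \<le> ell1_nth x j"
      using f by (intro tendsto_lowerbound[OF nth]) (auto simp: tree_points_def)
    show "ell1_nth x j \<le> l j"
      using f by (intro tendsto_upperbound[OF nth]) (auto simp: tree_points_def)
    fix i assume "ell1_nth x j \<noteq> 0" "i < j"
    have "\<forall>\<^sub>F n in sequentially. ell1_nth (f n) j \<noteq> 0"
      using nth[of j] \<open>ell1_nth x j \<noteq> 0\<close> by (rule tendsto_imp_eventually_ne)
    then have "\<forall>\<^sub>F n in sequentially. ell1_nth (f n) i = ell1_nth (g j) i"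
      by eventually_elim (use f \<open>i < j\<close> in \<open>auto intro: tree_points_prefix\<close>)
    then have "(\<lambda>n. ell1_nth (f n) i) \<longlonglongrightarrow> ell1_nth (g j) i"
      by (rule tendsto_eventually)
    then show "ell1_nth x i = ell1_nth (g j) i"
      using nth[of i] LIMSEQ_unique by blast
  qed
qed

lemma ell1_take_in_tree_points:
  assumes "x \<in> tree_points l g"
  shows "ell1_take n x \<in> tree_points_upto l g n"
proof -
  have "0 \<le> l j" for j
    using ell1_nonneg_nth[OF tree_points_nonneg[OF assms], of j] tree_points_le[OF assms, of j] by simp
  then show ?thesis
    using assms by (auto simp: tree_points_upto_def tree_points_def)
qed

lemma ell1_clip_in_tree_points:
  assumes x: "x \<in> tree_points l g"
  shows "ell1_clip x t \<in> tree_points l g"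
proof -
  define P where "P n = (\<Sum>i<n. ell1_nth x i)" for n
  have mono: "P m \<le> P n" if "m \<le> n" for m n
    unfolding P_def using that by (rule sum_ell1_nth_mono[OF tree_points_nonneg[OF x]])
  have clip: "ell1_nth (ell1_clip x t) j = min t (P (Suc j)) - min t (P j)" for j
    by (simp add: P_def)
  have nth: "ell1_nth x j = P (Suc j) - P j" for j
    by (simp add: P_def)
  show ?thesis
    unfolding tree_points_def
  proof (intro CollectI allI conjI impI)
    fix j
    show "0 \<le> ell1_nth (ell1_clip x t) j"
      unfolding clip using mono[of j "Suc j"] by auto
    have "ell1_nth (ell1_clip x t) j \<le> ell1_nth x j"
      unfolding clip nth using mono[of j "Suc j"] by (auto simp: min_def)
    also have "\<dots> \<le> l j" using x by (rule tree_points_le)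
    finally show "ell1_nth (ell1_clip x t) j \<le> l j" .
    fix i assume *: "ell1_nth (ell1_clip x t) j \<noteq> 0" and "i < j"
    then have "P j < t" "P j \<noteq> P (Suc j)"
      using mono[of j "Suc j"] unfolding clip by (auto simp: min_def split: if_splits)
    then have "ell1_nth (ell1_clip x t) i = ell1_nth x i"
      using mono[of i j] mono[of "Suc i" j] \<open>i < j\<close> unfolding clip nth by (simp add: min_def)
    moreover have "ell1_nth x j \<noteq> 0"
      using \<open>P j \<noteq> P (Suc j)\<close> by (simp add: nth)
    ultimately show "ell1_nth (ell1_clip x t) i = ell1_nth (g j) i"
      using tree_points_prefix[OF x _ \<open>i < j\<close>] by simp
  qed
qed

text \<open>Two points whose coordinates differ somewhere cannot meet again later: a later common
  coordinate would force the earlier ones to be those of the gluing point.\<close>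

lemma tree_points_disjoint_after:
  assumes "x \<in> tree_points l g" "y \<in> tree_points l g" "ell1_nth x k \<noteq> ell1_nth y k" "k < i"
  shows "ell1_nth x i = 0 \<or> ell1_nth y i = 0"
  using assms by (metis tree_points_prefix)

text \<open>The path goes from \<open>x\<close> down to the point where the paths from the root to \<open>x\<close> and to \<open>y\<close> separate, and
  from there up to \<open>y\<close>.\<close>

lemma tree_points_geodesic:
  assumes x: "x \<in> tree_points l g" and y: "y \<in> tree_points l g"
  obtains f where "\<And>s t. 0 \<le> s \<Longrightarrow> s \<le> t \<Longrightarrow> t \<le> 1 \<Longrightarrow> dist (f s) (f t) \<le> dist x y * (t - s)"
    and "f ` {0..1::real} \<subseteq> tree_points l g" and "f 0 = x" and "f 1 = y"
proof -
  let ?geo = "\<lambda>x y f. (\<forall>s t. 0 \<le> s \<longrightarrow> s \<le> t \<longrightarrow> t \<le> 1 \<longrightarrow> dist (f s) (f t) \<le> dist x y * (t - s)) \<and>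
    f ` {0..1::real} \<subseteq> tree_points l g \<and> f 0 = x \<and> f 1 = y"
  have geo: "\<exists>f. ?geo x y f"
    if x: "x \<in> tree_points l g" and y: "y \<in> tree_points l g"
      and eq: "\<And>i. i < k \<Longrightarrow> ell1_nth x i = ell1_nth y i" and less: "ell1_nth x k < ell1_nth y k"
    for x y k
  proof -
    define h where "h = (\<Sum>i<Suc k. ell1_nth x i)"
    note nn = tree_points_nonneg[OF x] tree_points_nonneg[OF y]
    have disj: "\<And>i. k < i \<Longrightarrow> ell1_nth x i = 0 \<or> ell1_nth y i = 0"
      using less by (intro tree_points_disjoint_after[OF x y]) auto
    note d = dist_disjoint_after[OF nn eq less disj, folded h_def]
    define A where "A = norm x - h"
    define p where "p r = (if r \<le> A then ell1_clip x (norm x - r) else ell1_clip y (h + (r - A)))" for r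
    have lip: "dist (p r) (p r') \<le> r' - r" if "r \<le> r'" for r r'
    proof -
      consider "r' \<le> A" | "r \<le> A" "A < r'" | "A < r" using that by linarith
      then show ?thesis
      proof cases
        case 1 then show ?thesis
          using that dist_ell1_clip[OF nn(1), of "norm x - r" "norm x - r'"] by (simp add: p_def)
      next
        case 2
        have "dist (p r) (p r') \<le> dist (p r) (ell1_clip x h) + dist (ell1_clip y h) (p r')"
          using d(2) by (simp add: dist_triangle)
        also have "dist (p r) (ell1_clip x h) \<le> A - r"
          using 2 dist_ell1_clip[OF nn(1), of "norm x - r" h] by (simp add: p_def A_def)
        also have "dist (ell1_clip y h) (p r') \<le> r' - A"
          using 2 dist_ell1_clip[OF nn(2), of h "h + (r' - A)"] by (simp add: p_def)
        finally show ?thesis by simp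
      next
        case 3 then show ?thesis
          using that dist_ell1_clip[OF nn(2), of "h + (r - A)" "h + (r' - A)"] by (simp add: p_def)
      qed
    qed
    have "p 0 = x" using d by (simp add: p_def A_def ell1_clip_full)
    moreover have "p (dist x y) = y"
    proof (cases "dist x y \<le> A")
      case True
      then have "norm y = h" "dist x y = A" using d by (auto simp: A_def)
      then have "p (dist x y) = ell1_clip x h" by (simp add: p_def A_def)
      then show ?thesis using d(2) \<open>norm y = h\<close> by (simp add: ell1_clip_full)
    qed (use d in \<open>simp add: p_def A_def ell1_clip_full\<close>)
    moreover have "dist (p (dist x y * s)) (p (dist x y * t)) \<le> dist x y * (t - s)" if "s \<le> t" for s t
      using lip[of "dist x y * s" "dist x y * t"] mult_left_mono[OF that, of "dist x y"]
      by (simp add: right_diff_distrib)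
    moreover have "p r \<in> tree_points l g" for r
      using x y by (simp add: p_def ell1_clip_in_tree_points)
    ultimately show ?thesis
      by (intro exI[of _ "\<lambda>t. p (dist x y * t)"]) auto
  qed
  have rev: "\<exists>f. ?geo x y f" if "\<exists>f. ?geo y x f" for x y
  proof -
    obtain f where f: "?geo y x f" using \<open>\<exists>f. ?geo y x f\<close> by blast
    have "dist (f (1 - s)) (f (1 - t)) \<le> dist x y * (t - s)" if "0 \<le> s" "s \<le> t" "t \<le> 1" for s t
    proof -
      have "dist (f (1 - t)) (f (1 - s)) \<le> dist y x * ((1 - s) - (1 - t))"
        using f that by (metis diff_ge_0_iff_ge diff_left_mono diff_le_eq le_add_same_cancel1)
      then show ?thesis by (simp add: dist_commute)
    qed
    then show ?thesis using f by (intro exI[of _ "\<lambda>t. f (1 - t)"]) auto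
  qed
  have "\<exists>f. ?geo x y f"
  proof (cases "x = y")
    case True
    then show ?thesis using x by (intro exI[of _ "\<lambda>_. x"]) auto
  next
    case False
    then obtain i where "ell1_nth x i \<noteq> ell1_nth y i" using ell1_eqI by blast
    define k where "k = (LEAST i. ell1_nth x i \<noteq> ell1_nth y i)"
    have k: "ell1_nth x k \<noteq> ell1_nth y k"
      unfolding k_def by (rule LeastI[of _ i]) fact
    have eq: "ell1_nth x i = ell1_nth y i" if "i < k" for i
      using that not_less_Least unfolding k_def by blast
    show ?thesis
    proof (cases "ell1_nth x k < ell1_nth y k")
      case True
      then show ?thesis using geo[OF x y eq] by blast
    next
      case False
      then have "\<exists>f. ?geo y x f" using k by (intro geo[where k = k, OF y x]) (auto simp: eq)
      then show ?thesis by (rule rev)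
    qed
  qed
  then show ?thesis using that by blast
qed

lemma length_dist_tree_points:
  assumes "x \<in> tree_points l g" "y \<in> tree_points l g"
  shows "length_dist (tree_points l g) x y = dist x y"
  by (rule tree_points_geodesic[OF assms]) (rule length_dist_eq_dist)

lemma leaves_tree_points:
  "leaves (tree_points l g) = {x \<in> tree_points l g. connected (tree_points l g - {x})}"
  by (rule leaves_eq_connected) (rule length_dist_tree_points)

text \<open>A point with infinite support is a leaf: it is not a proper clip of any point, so every
  other point is joined to the root by a path that avoids it.\<close>

lemma infinite_support_leaf:
  assumes x: "x \<in> tree_points l g" and inf: "\<And>n. \<exists>j\<ge>n. ell1_nth x j \<noteq> 0"
  shows "x \<in> leaves (tree_points l g)"
proof -
  let ?T = "tree_points l g"
  have avoid: "y = x" if y: "y \<in> ?T" and clip: "ell1_clip y t = x" for y t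
  proof (rule ell1_eqI)
    fix i
    define P where "P n = (\<Sum>i<n. ell1_nth y i)" for n
    have mono: "P m \<le> P n" if "m \<le> n" for m n
      unfolding P_def using that by (rule sum_ell1_nth_mono[OF tree_points_nonneg[OF y]])
    obtain j where j: "Suc i \<le> j" "ell1_nth x j \<noteq> 0" using inf by blast
    have "ell1_nth x j = min t (P (Suc j)) - min t (P j)" "ell1_nth x i = min t (P (Suc i)) - min t (P i)"
      using clip by (auto simp: P_def)
    then have "ell1_nth x i = P (Suc i) - P i"
      using j mono[of "Suc i" j] mono[of j "Suc j"] mono[of i j] by (auto simp: min_def split: if_splits)
    then show "ell1_nth y i = ell1_nth x i" by (simp add: P_def)
  qed
  have "?T - {x} = (\<Union>y\<in>?T - {x}. ell1_clip y ` {0..})"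
  proof (intro equalityI subsetI)
    fix y assume y: "y \<in> ?T - {x}"
    moreover have "y \<in> ell1_clip y ` {0..}"
      using ell1_clip_full[of y "norm y"] by (metis atLeast_iff image_eqI norm_ge_zero order_refl)
    ultimately show "y \<in> (\<Union>y\<in>?T - {x}. ell1_clip y ` {0..})" by blast
  next
    fix z assume "z \<in> (\<Union>y\<in>?T - {x}. ell1_clip y ` {0..})"
    then obtain y t where y: "y \<in> ?T" "y \<noteq> x" and z: "z = ell1_clip y t" by blast
    then have "z \<noteq> x" using avoid by metis
    then show "z \<in> ?T - {x}" using ell1_clip_in_tree_points[OF y(1)] z by simp
  qed
  moreover have "connected (\<Union>y\<in>?T - {x}. ell1_clip y ` {0..})"
  proof (rule connected_Union)
    fix S assume "S \<in> (\<lambda>y. ell1_clip y ` {0..}) ` (?T - {x})"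
    then show "connected S"
      using tree_points_nonneg by (auto intro!: connected_continuous_image continuous_on_ell1_clip)
  next
    have "0 \<in> ell1_clip y ` {0..}" if "y \<in> ?T" for y
      using ell1_clip_zero[OF tree_points_nonneg[OF that]] by (metis atLeast_iff image_eqI order_refl)
    then have "\<Inter>((\<lambda>y. ell1_clip y ` {0..}) ` (?T - {x})) \<noteq> {} \<or> ?T - {x} = {}"
      by blast
    then show "\<Inter>((\<lambda>y. ell1_clip y ` {0..}) ` (?T - {x})) \<noteq> {}"
      by auto
  qed
  ultimately show ?thesis using x by (simp add: leaves_tree_points)
qed

locale glued_tree =
  fixes l :: "nat \<Rightarrow> real" and g :: "nat \<Rightarrow> ell1"
  assumes l_pos: "\<And>c. 0 < l c"
    and g_upto: "\<And>n. g n \<in> tree_points_upto l g n"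
begin

lemma g_tree: "g n \<in> tree_points l g"
  using g_upto tree_points_upto_subset by blast

lemma g_beyond: "n \<le> j \<Longrightarrow> ell1_nth (g n) j = 0"
  using g_upto[of n] by (simp add: tree_points_upto_def)

end

lemma branch_in_tree_points_upto:
  assumes g: "g c \<in> tree_points_upto l g c" and t: "0 \<le> t" "t \<le> l c" and "c < n"
  shows "g c + t *\<^sub>R unit_ell1 c \<in> tree_points_upto l g n"
proof -
  have 0: "ell1_nth (g c) j = 0" if "c \<le> j" for j
    using g that by (simp add: tree_points_upto_def)
  show ?thesis
    unfolding tree_points_upto_def tree_points_def mem_Collect_eq
  proof (intro conjI allI impI)
    fix j
    have b: "0 \<le> ell1_nth (g c) j" "ell1_nth (g c) j \<le> l j"
      using g by (simp_all add: tree_points_upto_def tree_points_def)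
    show "0 \<le> ell1_nth (g c + t *\<^sub>R unit_ell1 c) j" using b t by simp
    show "ell1_nth (g c + t *\<^sub>R unit_ell1 c) j \<le> l j" using b t 0[of j] by auto
    show "ell1_nth (g c + t *\<^sub>R unit_ell1 c) j = 0" if "n \<le> j"
      using 0[of j] \<open>c < n\<close> that by auto
    fix i assume "ell1_nth (g c + t *\<^sub>R unit_ell1 c) j \<noteq> 0" and "i < j"
    then consider "j = c" | "j \<noteq> c" "ell1_nth (g c) j \<noteq> 0" by fastforce
    then show "ell1_nth (g c + t *\<^sub>R unit_ell1 c) i = ell1_nth (g j) i"
    proof cases
      case 2
      then have "j < c" using 0[of j] by force
      then show ?thesis
        using g 2 \<open>i < j\<close> by (auto simp: tree_points_upto_def intro: tree_points_prefix)
    qed (use \<open>i < j\<close> in auto)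
  qed
qed

text \<open>Conversely, the last nonzero coordinate tells the branch on which a point lies.\<close>

lemma tree_points_upto_cases:
  assumes x: "x \<in> tree_points_upto l g n" and g: "\<And>c. c < n \<Longrightarrow> g c \<in> tree_points_upto l g c"
  shows "x = 0 \<or> (\<exists>c<n. 0 < ell1_nth x c \<and> x = g c + ell1_nth x c *\<^sub>R unit_ell1 c)"
proof (rule disjCI, rule ccontr)
  assume *: "\<not> (\<exists>c<n. 0 < ell1_nth x c \<and> x = g c + ell1_nth x c *\<^sub>R unit_ell1 c)" and "x \<noteq> 0"
  define S where "S = {j. ell1_nth x j \<noteq> 0}"
  have "S \<subseteq> {..<n}"
    using x by (auto simp: S_def tree_points_upto_def not_le[symmetric])
  then have "finite S" by (rule finite_subset) simp
  moreover have "S \<noteq> {}"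
    using \<open>x \<noteq> 0\<close> ell1_eqI[of x 0] by (auto simp: S_def)
  ultimately have c: "Max S \<in> S" and above: "\<And>j. j \<in> S \<Longrightarrow> j \<le> Max S" by auto
  define c where "c = Max S"
  have "c < n" using c \<open>S \<subseteq> {..<n}\<close> by (auto simp: c_def)
  have "x = g c + ell1_nth x c *\<^sub>R unit_ell1 c"
  proof (rule ell1_eqI)
    fix j
    have "ell1_nth (g c) j = 0" if "c \<le> j"
      using g[OF \<open>c < n\<close>] that by (simp add: tree_points_upto_def)
    moreover have "ell1_nth x j = ell1_nth (g c) j" if "j < c"
      using x c that by (auto simp: c_def S_def tree_points_upto_def intro: tree_points_prefix)
    moreover have "ell1_nth x j = 0" if "c < j"
      using above[of j] that by (auto simp: c_def S_def)
    ultimately show "ell1_nth x j = ell1_nth (g c + ell1_nth x c *\<^sub>R unit_ell1 c) j"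
      by (cases j c rule: linorder_cases) auto
  qed
  moreover have "0 < ell1_nth x c"
    using c ell1_nonneg_nth[OF tree_points_nonneg, of x l g c] x tree_points_upto_subset[of l g n]
    unfolding c_def S_def by (simp add: order_less_le subset_iff)
  ultimately show False
    using \<open>c < n\<close> * by blast
qed

text \<open>With the root as the starting point of the first branch, all branches are described in the same
  way, and the sets above are the trees of the aggregation.\<close>

definition branch_start :: "(nat \<Rightarrow> ell1) \<Rightarrow> nat \<Rightarrow> ell1"
  where "branch_start u c = (if c = 0 then 0 else u c)"

lemma branch_point_Suc: "branch_point u (Suc c) t = branch_start u c + t *\<^sub>R unit_ell1 c"
  by (simp add: branch_point_def branch_start_def)

lemma finite_tree_eq_tree_points_upto:
  assumes g: "\<And>c. c < n \<Longrightarrow> branch_start u c \<in> tree_points_upto (\<lambda>c. a (Suc c)) (branch_start u) c"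
    and a: "\<And>i. i \<ge> 1 \<Longrightarrow> a i > 0" and "1 \<le> n"
  shows "finite_tree a u n = tree_points_upto (\<lambda>c. a (Suc c)) (branch_start u) n"
proof (intro equalityI subsetI)
  fix x assume "x \<in> finite_tree a u n"
  then obtain i t where i: "i \<in> {1..n}" "x = branch_point u i t" "t \<in> {0..a i}"
    by (auto simp: finite_tree_def)
  obtain c where "i = Suc c" using i(1) by (cases i) auto
  then show "x \<in> tree_points_upto (\<lambda>c. a (Suc c)) (branch_start u) n"
    using i g[of c] branch_in_tree_points_upto[of "branch_start u" c "\<lambda>c. a (Suc c)" t n]
    by (simp add: branch_point_Suc)
next
  fix x assume x: "x \<in> tree_points_upto (\<lambda>c. a (Suc c)) (branch_start u) n"
  from tree_points_upto_cases[OF x g] consider "x = 0"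
    | c where "c < n" "0 < ell1_nth x c" "x = branch_start u c + ell1_nth x c *\<^sub>R unit_ell1 c"
    by blast
  then show "x \<in> finite_tree a u n"
  proof cases
    case 1
    have "x = branch_point u 1 0" using 1 by (simp add: branch_point_def)
    moreover have "0 \<in> {0..a 1}" "1 \<in> {1..n}" using a[of 1] \<open>1 \<le> n\<close> by auto
    ultimately show ?thesis unfolding finite_tree_def by blast
  next
    case 2
    have "x = branch_point u (Suc c) (ell1_nth x c)" using 2 by (simp add: branch_point_Suc)
    moreover have "ell1_nth x c \<in> {0..a (Suc c)}" "Suc c \<in> {1..n}"
      using 2 x by (auto simp: tree_points_upto_def tree_points_def)
    ultimately show ?thesis unfolding finite_tree_def by blast
  qed
qed

text \<open>The truncations of a point lie in the finite trees and converge to it, so \<open>tree_points\<close> contains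
  nothing beyond the closure.\<close>

lemma limit_tree_eq_tree_points:
  assumes g: "\<And>c. branch_start u c \<in> tree_points_upto (\<lambda>c. a (Suc c)) (branch_start u) c"
    and a: "\<And>i. i \<ge> 1 \<Longrightarrow> a i > 0"
  shows "limit_tree a u = tree_points (\<lambda>c. a (Suc c)) (branch_start u)"
proof -
  let ?T = "tree_points (\<lambda>c. a (Suc c)) (branch_start u)"
  have ft: "finite_tree a u n = tree_points_upto (\<lambda>c. a (Suc c)) (branch_start u) n" if "1 \<le> n" for n
    using g a that by (rule finite_tree_eq_tree_points_upto)
  have "closure (\<Union>n\<in>{1..}. finite_tree a u n) \<subseteq> ?T"
    using tree_points_upto_subset closed_tree_points
    by (intro closure_minimal) (auto simp: ft subset_iff)
  moreover have "x \<in> closure (\<Union>n\<in>{1..}. finite_tree a u n)" if "x \<in> ?T" for x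
    unfolding closure_sequential
  proof (intro exI conjI allI)
    fix n
    have "ell1_take (Suc n) x \<in> finite_tree a u (Suc n)"
      using ell1_take_in_tree_points[OF that] by (simp add: ft)
    then show "ell1_take (Suc n) x \<in> (\<Union>n\<in>{1..}. finite_tree a u n)" by auto
  next
    show "(\<lambda>n. ell1_take (Suc n) x) \<longlonglongrightarrow> x"
      using ell1_take_tendsto by (rule LIMSEQ_Suc)
  qed
  ultimately show ?thesis unfolding limit_tree_def by blast
qed

text \<open>Removing an inner point of a branch separates what lies above it from the rest. The part above is
  relatively open: a point of it with \<open>c\<close>-th coordinate exactly \<open>t\<close> is reached through a branch
  glued there, and so are all points of the tree close to it.\<close>

lemma (in glued_tree) inner_point_not_leaf:
  assumes "0 < t" "t < l c"
  shows "g c + t *\<^sub>R unit_ell1 c \<notin> leaves (tree_points l g)"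
proof
  let ?x = "g c + t *\<^sub>R unit_ell1 c" and ?T = "tree_points l g"
  assume "?x \<in> leaves ?T"
  then have con: "connected (?T - {?x})" by (simp add: leaves_tree_points)
  define A where "A = {y. t < ell1_nth y c} \<union> (\<Union>j\<in>{j. c < j \<and> ell1_nth (g j) c = t}. {y. ell1_nth y j \<noteq> 0})"
  define B where "B = {y. ell1_nth y c < t}"
  have "open A" unfolding A_def
    by (intro open_Un open_UN ballI open_Collect_less open_Collect_neq continuous_intros)
  have "open B" unfolding B_def
    by (intro open_Collect_less continuous_intros)
  have "?T - {?x} \<subseteq> A \<union> B"
  proof
    fix y assume y: "y \<in> ?T - {?x}"
    show "y \<in> A \<union> B"
    proof (cases "ell1_nth y c = t")
      case True
      have "\<exists>j>c. ell1_nth y j \<noteq> 0"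
      proof (rule ccontr)
        assume *: "\<not> (\<exists>j>c. ell1_nth y j \<noteq> 0)"
        have "y = ?x"
        proof (rule ell1_eqI)
          fix i
          show "ell1_nth y i = ell1_nth ?x i"
            using * True \<open>0 < t\<close> y g_beyond[of c i] tree_points_prefix[of y l g c i]
            by (cases i c rule: linorder_cases) auto
        qed
        then show False using y by simp
      qed
      then obtain j where j: "c < j" "ell1_nth y j \<noteq> 0" by blast
      then have "ell1_nth (g j) c = t" using tree_points_prefix[of y l g j c] y True by simp
      then show ?thesis using j by (auto simp: A_def)
    qed (auto simp: A_def B_def)
  qed
  moreover have "A \<inter> B \<inter> (?T - {?x}) = {}"
    by (auto simp: A_def B_def dest: tree_points_prefix)
  moreover have "A \<inter> (?T - {?x}) \<noteq> {}"
  proof -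
    have "g c + l c *\<^sub>R unit_ell1 c \<in> tree_points_upto l g (Suc c)"
      using l_pos[of c] by (intro branch_in_tree_points_upto g_upto) auto
    moreover have "ell1_nth (g c + l c *\<^sub>R unit_ell1 c) c = l c" using g_beyond[of c c] by simp
    moreover have "ell1_nth ?x c = t" using g_beyond[of c c] by simp
    ultimately have "g c + l c *\<^sub>R unit_ell1 c \<in> A \<inter> (?T - {?x})"
      using assms tree_points_upto_subset unfolding A_def by (auto simp del: ell1_nth_simps)
    then show ?thesis by blast
  qed
  moreover have "B \<inter> (?T - {?x}) \<noteq> {}"
  proof -
    have "ell1_nth (g c) c = 0" using g_beyond[of c c] by simp
    moreover have "ell1_nth ?x c = t" using g_beyond[of c c] by simp
    ultimately have "g c \<in> B \<inter> (?T - {?x})"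
      using assms g_tree[of c] unfolding B_def by (auto simp del: ell1_nth_simps)
    then show ?thesis by blast
  qed
  ultimately show False
    using connectedD[OF con \<open>open A\<close> \<open>open B\<close>] by blast
qed

lemma (in glued_tree) finite_support_leaf:
  assumes "x \<in> leaves (tree_points l g)" and "\<And>j. j \<ge> n \<Longrightarrow> ell1_nth x j = 0"
  shows "x = 0 \<or> (\<exists>c<n. x = g c + l c *\<^sub>R unit_ell1 c)"
proof -
  have x: "x \<in> tree_points_upto l g n"
    using assms by (auto simp: leaves_tree_points tree_points_upto_def)
  from tree_points_upto_cases[OF x g_upto] show ?thesis
  proof (elim disjE exE conjE)
    fix c assume c: "c < n" "0 < ell1_nth x c" "x = g c + ell1_nth x c *\<^sub>R unit_ell1 c"
    then have "\<not> ell1_nth x c < l c" using assms(1) inner_point_not_leaf by metis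
    moreover have "ell1_nth x c \<le> l c"
      using x tree_points_le tree_points_upto_subset by blast
    ultimately show ?thesis using c by (metis order_less_le)
  qed simp
qed

section \<open>Hausdorff measures: two criteria\<close>

lemma metric_diameter_le:
  "(\<And>x y. x \<in> S \<Longrightarrow> y \<in> S \<Longrightarrow> d x y \<le> r) \<Longrightarrow> metric_diameter d S \<le> ennreal r"
  unfolding metric_diameter_def by (rule SUP_least) (auto intro: ennreal_leI)

lemma le_enn2real_metric_diameter:
  assumes "metric_diameter d S \<le> ennreal \<delta>" and "x \<in> S" "y \<in> S"
  shows "d x y \<le> enn2real (metric_diameter d S)"
proof (cases "0 \<le> d x y")
  case True
  have "metric_diameter d S < \<top>"
    using assms(1) by (rule order_le_less_trans) simp
  moreover have "ennreal (d x y) \<le> metric_diameter d S"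
    unfolding metric_diameter_def using assms(2,3) by (intro SUP_upper2[of "(x, y)"]) auto
  ultimately show ?thesis using True
    by (metis enn2real_ennreal enn2real_mono)
next
  case False
  then show ?thesis by (meson enn2real_nonneg linear order_trans)
qed

text \<open>A map from the unit interval into \<open>S\<close> with a Hoelder inverse makes every cover of \<open>S\<close> a cover
  of the unit interval by sets of comparable size, so Lebesgue measure bounds the cover from below.\<close>

lemma hausdorff_measure_neq_0:
  fixes z :: "real \<Rightarrow> 'a"
  assumes z: "\<And>t. t \<in> {0..<1} \<Longrightarrow> z t \<in> S" and "0 < C"
    and inv: "\<And>t t'. t \<in> {0..<1} \<Longrightarrow> t' \<in> {0..<1} \<Longrightarrow> \<bar>t - t'\<bar> \<le> C * d (z t) (z t') powr s"
    and d: "\<And>x y. 0 \<le> d x y" and r: "0 < r" "r \<le> s"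
  shows "hausdorff_measure X d r S \<noteq> 0"
proof -
  have cover: "ennreal (1 / (2 * C)) \<le> (\<Sum>i. ennreal (enn2real (metric_diameter d (A i)) powr r))"
    if A: "S \<subseteq> (\<Union>i. A i)" "\<And>i. metric_diameter d (A i) \<le> ennreal 1" for A :: "nat \<Rightarrow> 'a set"
  proof -
    define D where "D i = enn2real (metric_diameter d (A i))" for i
    have D: "0 \<le> D i" "D i \<le> 1" for i
      using enn2real_mono[OF A(2)[of i]] by (simp_all add: D_def)
    define E where "E i = {t \<in> {0..<1}. z t \<in> A i}" for i
    define t0 where "t0 i = (SOME t. t \<in> E i)" for i
    define I where "I i = (if E i = {} then {} else {t0 i - C * D i powr r..t0 i + C * D i powr r})" for i
    have E_sub: "E i \<subseteq> I i" for i
    proof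
      fix t assume t: "t \<in> E i"
      then have t0: "t0 i \<in> E i" unfolding t0_def by (rule someI)
      have "\<bar>t - t0 i\<bar> \<le> C * d (z t) (z (t0 i)) powr s"
        using t t0 by (intro inv) (auto simp: E_def)
      also have "\<dots> \<le> C * D i powr s"
        using t t0 \<open>0 < C\<close> r d le_enn2real_metric_diameter[OF A(2), of "z t" i "z (t0 i)"]
        by (intro mult_left_mono powr_mono2) (auto simp: E_def D_def)
      also have "\<dots> \<le> C * D i powr r"
        using D[of i] r \<open>0 < C\<close> by (intro mult_left_mono powr_mono') auto
      finally show "t \<in> I i" using t unfolding I_def by (auto simp: abs_le_iff)
    qed
    have "{0..<1} \<subseteq> (\<Union>i. E i)"
    proof
      fix t :: real assume t: "t \<in> {0..<1}"
      then obtain i where "z t \<in> A i" using z[OF t] A(1) by blast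
      then have "t \<in> E i" using t by (simp add: E_def)
      then show "t \<in> (\<Union>i. E i)" by blast
    qed
    also have "\<dots> \<subseteq> (\<Union>i. I i)" by (rule UN_mono[OF order_refl E_sub])
    finally have sub: "{0..<1} \<subseteq> (\<Union>i. I i)" .
    have I: "range I \<subseteq> sets lborel" by (auto simp: I_def)
    have "1 = emeasure lborel {0..<1::real}" by simp
    also have "\<dots> \<le> emeasure lborel (\<Union>i. I i)"
      using sub I by (intro emeasure_mono sets.countable_UN)
    also have "\<dots> \<le> (\<Sum>i. emeasure lborel (I i))"
      using I by (rule emeasure_subadditive_countably)
    also have "\<dots> \<le> (\<Sum>i. ennreal (2 * C) * ennreal (D i powr r))"
    proof (intro suminf_le allI summableI)
      fix i
      have "0 \<le> C * D i powr r" using \<open>0 < C\<close> by simp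
      then have "emeasure lborel (I i) \<le> ennreal (2 * C * D i powr r)"
        by (simp add: I_def emeasure_lborel_Icc)
      then show "emeasure lborel (I i) \<le> ennreal (2 * C) * ennreal (D i powr r)"
        using \<open>0 < C\<close> by (simp add: ennreal_mult)
    qed
    also have "\<dots> = ennreal (2 * C) * (\<Sum>i. ennreal (D i powr r))"
      by (rule ennreal_suminf_cmult)
    finally have "ennreal (1 / (2 * C)) * 1 \<le> ennreal (1 / (2 * C)) * (ennreal (2 * C) * (\<Sum>i. ennreal (D i powr r)))"
      by (rule mult_left_mono) simp
    also have "\<dots> = (\<Sum>i. ennreal (D i powr r))"
      using \<open>0 < C\<close> by (simp add: mult.assoc[symmetric] ennreal_mult[symmetric])
    finally show ?thesis by (simp add: D_def)
  qed
  have "ennreal (1 / (2 * C)) \<le> hausdorff_premeasure X d r 1 S"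
    unfolding hausdorff_premeasure_def using cover by (intro INF_greatest) auto
  also have "\<dots> \<le> hausdorff_measure X d r S"
    unfolding hausdorff_measure_def by (rule SUP_upper) simp
  finally show ?thesis using \<open>0 < C\<close> by auto
qed

text \<open>The leaves below branch \<open>c + 1\<close> lie within the radius \<open>K c\<^bsup>-\<beta>\<^esup>\<close> of its starting point. A leaf
  with infinite support is below branches of arbitrarily large index, and only finitely many leaves
  have their support below \<open>N\<close>.\<close>

lemma (in glued_tree) hausdorff_measure_leaves_eq_0:
  assumes tail: "\<And>x c. x \<in> tree_points l g \<Longrightarrow> N\<^sub>0 \<le> c \<Longrightarrow>
      dist x (ell1_take c x) \<le> K * real c powr - \<beta>"
    and "0 < K" "0 < \<beta>" "0 < s" "1 < \<beta> * s"
  shows "hausdorff_measure (tree_points l g) (length_dist (tree_points l g)) s (leaves (tree_points l g)) = 0"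
proof -
  let ?T = "tree_points l g"
  let ?d = "length_dist ?T"
  define f where "f c = (2 * K * real c powr - \<beta>) powr s" for c :: nat
  have "f c = (2 * K) powr s * real c powr (- \<beta> * s)" for c
    using \<open>0 < K\<close> by (simp add: f_def powr_mult powr_powr)
  moreover have "summable (\<lambda>c. (2 * K) powr s * real c powr (- \<beta> * s))"
    using \<open>1 < \<beta> * s\<close> by (intro summable_mult) (simp add: summable_real_powr_iff)
  ultimately have sf: "summable f" by presburger
  have pre: "hausdorff_premeasure ?T ?d s \<delta> (leaves ?T) \<le> 0 + ennreal e" if "0 < \<delta>" "0 < e" for \<delta> e
  proof -
    obtain N1 where N1: "\<And>n. N1 \<le> n \<Longrightarrow> norm (\<Sum>i. f (i + n)) < e"
      using suminf_exist_split[OF \<open>0 < e\<close> sf] by blast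
    have "(\<lambda>c. 2 * K * real c powr - \<beta>) \<longlonglongrightarrow> 0"
      using \<open>0 < \<beta>\<close> by real_asymp
    then have "\<forall>\<^sub>F c in sequentially. 2 * K * real c powr - \<beta> < \<delta>"
      using \<open>0 < \<delta>\<close> by (rule order_tendstoD)
    then obtain N2 where N2: "\<And>c. N2 \<le> c \<Longrightarrow> 2 * K * real c powr - \<beta> < \<delta>"
      by (auto simp: eventually_sequentially)
    define N where "N = Max {N\<^sub>0, N1, N2}"
    have N: "N\<^sub>0 \<le> N" "N1 \<le> N" "N2 \<le> N" by (auto simp: N_def)
    define A where "A i = (case i of 0 \<Rightarrow> {0} | Suc c \<Rightarrow> if c < N then {g c + l c *\<^sub>R unit_ell1 c}
      else {x \<in> ?T. dist x (g c) \<le> K * real c powr - \<beta>})" for i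
    have "0 \<in> ?T" using l_pos by (auto simp: tree_points_def less_imp_le)
    have "g c + l c *\<^sub>R unit_ell1 c \<in> ?T" for c
      using branch_in_tree_points_upto[OF g_upto, of "l c" c "Suc c"] l_pos[of c] tree_points_upto_subset
      by force
    then have A_sub: "A i \<subseteq> ?T" for i
      using \<open>0 \<in> ?T\<close> by (cases i) (auto simp: A_def)
    define h where "h i = (if i < Suc N then 0 else f (i - 1))" for i
    have diam: "metric_diameter ?d (A i) \<le> ennreal (if i < Suc N then 0 else 2 * K * real (i - 1) powr - \<beta>)" for i
    proof (rule metric_diameter_le)
      fix x y assume xy: "x \<in> A i" "y \<in> A i"
      then have "?d x y = dist x y"
        using A_sub by (intro length_dist_tree_points) auto
      also have "dist x y \<le> (if i < Suc N then 0 else 2 * K * real (i - 1) powr - \<beta>)"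
      proof (cases "i < Suc N")
        case True
        then show ?thesis using xy by (cases i) (auto simp: A_def)
      next
        case False
        then obtain c where c: "i = Suc c" "N \<le> c" by (cases i) auto
        have "dist x y \<le> dist x (g c) + dist y (g c)" by (rule dist_triangle2)
        then show ?thesis using xy c by (auto simp: A_def)
      qed
      finally show "?d x y \<le> (if i < Suc N then 0 else 2 * K * real (i - 1) powr - \<beta>)" .
    qed
    have "leaves ?T \<subseteq> (\<Union>i. A i)"
    proof
      fix x assume x: "x \<in> leaves ?T"
      then have xT: "x \<in> ?T" by (simp add: leaves_tree_points)
      show "x \<in> (\<Union>i. A i)"
      proof (cases "\<exists>c\<ge>N. ell1_nth x c \<noteq> 0")
        case True
        then obtain c where c: "N \<le> c" "ell1_nth x c \<noteq> 0" by blast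
        have "ell1_take c x = g c"
          using tree_points_prefix[OF xT c(2)] g_beyond[of c] by (intro ell1_eqI) auto
        then have "x \<in> A (Suc c)"
          using tail[OF xT, of c] c N xT by (simp add: A_def)
        then show ?thesis by blast
      next
        case False
        then consider "x = 0" | c where "c < N" "x = g c + l c *\<^sub>R unit_ell1 c"
          using finite_support_leaf[OF x, of N] by blast
        then show ?thesis
        proof cases
          case 1
          then have "x \<in> A 0" by (simp add: A_def)
          then show ?thesis by blast
        next
          case (2 c)
          then have "x \<in> A (Suc c)" by (simp add: A_def)
          then show ?thesis by blast
        qed
      qed
    qed
    moreover have "metric_diameter ?d (A i) \<le> ennreal \<delta>" for i
    proof -
      have "(if i < Suc N then 0 else 2 * K * real (i - 1) powr - \<beta>) \<le> \<delta>"
      proof (cases "i < Suc N")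
        case False
        then have "N2 \<le> i - 1" using N(3) by linarith
        then show ?thesis using N2 False by (simp add: less_imp_le del: of_nat_diff)
      qed (use \<open>0 < \<delta>\<close> in simp)
      then show ?thesis using diam[of i] ennreal_leI order_trans by blast
    qed
    ultimately have "hausdorff_premeasure ?T ?d s \<delta> (leaves ?T)
      \<le> (\<Sum>i. ennreal (enn2real (metric_diameter ?d (A i)) powr s))"
      unfolding hausdorff_premeasure_def using A_sub by (intro INF_lower) auto
    also have "\<dots> \<le> (\<Sum>i. ennreal (h i))"
    proof (intro suminf_le ennreal_leI)
      fix i
      have "enn2real (metric_diameter ?d (A i)) \<le> (if i < Suc N then 0 else 2 * K * real (i - 1) powr - \<beta>)"
        using enn2real_mono[OF diam[of i]] \<open>0 < K\<close> by (simp split: if_splits)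
      then have "enn2real (metric_diameter ?d (A i)) powr s
          \<le> (if i < Suc N then 0 else 2 * K * real (i - 1) powr - \<beta>) powr s"
        using \<open>0 < s\<close> by (intro powr_mono2) auto
      then show "enn2real (metric_diameter ?d (A i)) powr s \<le> h i"
        by (simp add: h_def f_def split: if_splits)
    qed auto
    also have "\<dots> = ennreal (\<Sum>i. h i)"
    proof (rule suminf_ennreal2)
      show "0 \<le> h i" for i by (simp add: h_def f_def)
      have "summable (\<lambda>i. h (i + Suc N))"
        using sf by (simp add: h_def summable_iff_shift)
      then show "summable h" by (simp only: summable_iff_shift)
    qed
    also have "(\<Sum>i. h i) = (\<Sum>i. f (i + N))"
    proof -
      have "summable (\<lambda>i. h (i + Suc N))"
        using sf by (simp add: h_def summable_iff_shift)
      then have "summable h" by (simp only: summable_iff_shift)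
      then have "(\<Sum>i. h i) = (\<Sum>i. h (i + Suc N)) + (\<Sum>i<Suc N. h i)"
        by (rule suminf_split_initial_segment)
      then show ?thesis by (simp add: h_def)
    qed
    also have "ennreal (\<Sum>i. f (i + N)) \<le> ennreal e"
      using N1[OF N(2)] by (intro ennreal_leI) auto
    finally show ?thesis by simp
  qed
  have "hausdorff_premeasure ?T ?d s \<delta> (leaves ?T) \<le> 0" if "0 < \<delta>" for \<delta>
    using pre[OF that] by (rule ennreal_le_epsilon)
  then have "hausdorff_measure ?T ?d s (leaves ?T) \<le> 0"
    unfolding hausdorff_measure_def by (intro SUP_least) auto
  then show ?thesis by simp
qed

section \<open>A Cantor set of leaves\<close>

text \<open>When each branch is glued on the preceding one, passing to the next branch leaves the earlier
  coordinates of the starting points unchanged. So these converge coordinatewise, to a summable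
  sequence because the lengths are summable, and the limit is a leaf because its support is infinite.\<close>

lemma (in glued_tree) chain_limit_leaf:
  assumes "summable l" and chain: "\<And>k. 0 < ell1_nth (g (b (Suc k))) (b k)"
  obtains x where "x \<in> leaves (tree_points l g)"
    and "\<And>k i. i < b k \<Longrightarrow> ell1_nth x i = ell1_nth (g (b k)) i"
proof -
  have less: "b k < b (Suc k)" for k
    using chain[of k] g_beyond[of "b (Suc k)" "b k"] by (metis less_irrefl not_le)
  then have "strict_mono b" by (rule strict_monoI_Suc)
  then have ge: "k \<le> b k" for k by (rule strict_mono_imp_increasing)
  have step: "ell1_nth (g (b (Suc k))) i = ell1_nth (g (b k)) i" if "i < b k" for k i
    using tree_points_prefix[OF g_tree _ that] chain[of k] by simp
  have stable: "ell1_nth (g (b n)) i = ell1_nth (g (b k)) i" if "i < b k" "k \<le> n" for k n i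
    using that(2)
  proof (induction n rule: dec_induct)
    case (step n)
    have "b k \<le> b n" using \<open>strict_mono b\<close> step(1) by (simp add: strict_mono_less_eq)
    then show ?case using step \<open>i < b k\<close> \<open>\<And>k i. i < b k \<Longrightarrow> _\<close>[of i n] by simp
  qed simp
  define x where "x = Abs_ell1 (\<lambda>i. ell1_nth (g (b (Suc i))) i)"
  have bound: "0 \<le> ell1_nth (g n) i" "ell1_nth (g n) i \<le> l i" for n i
    using g_tree[of n] by (simp_all add: tree_points_def)
  have "summable (\<lambda>i. \<bar>ell1_nth (g (b (Suc i))) i\<bar>)"
    by (rule summable_comparison_test'[OF \<open>summable l\<close>, of 0]) (simp add: bound)
  then have x: "ell1_nth x i = ell1_nth (g (b (Suc i))) i" for i
    by (simp add: x_def Abs_ell1_inverse)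
  have prefix: "ell1_nth x i = ell1_nth (g (b k)) i" if "i < b k" for k i
  proof -
    have "i < b (Suc i)" using ge[of "Suc i"] by simp
    then show ?thesis
      using stable[of i "Suc i" k] stable[of i k "Suc i"] that x[of i] by (cases "k \<le> Suc i") auto
  qed
  have "x \<in> tree_points l g"
    unfolding tree_points_def
  proof (intro CollectI allI conjI impI)
    fix j
    show "0 \<le> ell1_nth x j" "ell1_nth x j \<le> l j" by (simp_all add: x bound)
    fix i assume "ell1_nth x j \<noteq> 0" "i < j"
    moreover have "j < b (Suc j)" using ge[of "Suc j"] by simp
    ultimately show "ell1_nth x i = ell1_nth (g j) i"
      using prefix[of j "Suc j"] prefix[of i "Suc j"] tree_points_prefix[OF g_tree, of "b (Suc j)" j i] by simp
  qed
  moreover have "\<exists>j\<ge>n. ell1_nth x j \<noteq> 0" for n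
    using ge[of n] prefix[OF less[of n]] chain[of n] by (intro exI[of _ "b n"]) auto
  ultimately have "x \<in> leaves (tree_points l g)" by (rule infinite_support_leaf)
  then show ?thesis using prefix that by blast
qed

text \<open>Branches of generation \<open>k\<close> have \<open>m k\<close> cells of width \<open>w k\<close>, and in the upper half of each
  cell a branch of generation \<open>k + 1\<close> is glued. The digits of \<open>t\<close> in the mixed radix system with
  bases \<open>m 0, m 1, \<dots>\<close> select the cells followed to reach a leaf. The leaves of two numbers whose digits
  first differ by \<open>q\<close> in generation \<open>k\<close> are at distance at least \<open>w k q / 2\<close>; the hypothesis on \<open>C\<close>
  is what makes this Hoelder for \<open>q = m k\<close>, the worst case because \<open>s \<le> 1\<close>.\<close>

lemma (in glued_tree) cantor_leaves:
  fixes J :: "nat \<Rightarrow> nat set" and m :: "nat \<Rightarrow> nat" and w :: "nat \<Rightarrow> real" and s C :: real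
  assumes "summable l" and c0: "c\<^sub>0 \<in> J 0"
    and child: "\<And>k c p. c \<in> J k \<Longrightarrow> p < m k \<Longrightarrow> \<exists>d\<in>J (Suc k).
      ell1_nth (g d) c \<in> {w k * (real p + 1 / 2)..w k * (real p + 1)}"
    and w: "\<And>k. 0 < w k" and m: "\<And>k. 2 \<le> m k" and s: "0 < s" "s \<le> 1"
    and C: "\<And>k. 1 \<le> C * (\<Prod>i<k. real (m i)) * (real (m k) * w k) powr s"
  obtains z where "\<And>t. t \<in> {0..<1::real} \<Longrightarrow> z t \<in> leaves (tree_points l g)"
    and "\<And>t t'. t \<in> {0..<1} \<Longrightarrow> t' \<in> {0..<1} \<Longrightarrow> \<bar>t - t'\<bar> \<le> 4 * C * dist (z t) (z t') powr s"
proof -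
  define M where "M k = (\<Prod>i<k. real (m i))" for k
  have M_Suc: "M (Suc k) = M k * real (m k)" for k by (simp add: M_def)
  have M_pos: "0 < M k" for k
    unfolding M_def using m by (intro prod_pos) (metis gr0I not_numeral_le_zero of_nat_0_less_iff)
  have M_ge: "2 ^ k \<le> M k" for k
  proof (induction k)
    case (Suc k)
    have "2 ^ k * 2 \<le> M k * real (m k)"
      using Suc m[of k] by (intro mult_mono) (auto simp: M_pos less_imp_le)
    then show ?case by (simp add: M_Suc)
  qed (simp add: M_def)
  have "0 < C"
  proof (rule ccontr)
    assume "\<not> 0 < C"
    then have "C * (real (m 0) * w 0) powr s \<le> 0" by (simp add: mult_nonpos_nonneg)
    then show False using C[of 0] by simp
  qed
  define ch where "ch k c p = (SOME d. d \<in> J (Suc k) \<and>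
      ell1_nth (g d) c \<in> {w k * (real p + 1 / 2)..w k * (real p + 1)})" for k c p
  have ch: "ch k c p \<in> J (Suc k) \<and>
      ell1_nth (g (ch k c p)) c \<in> {w k * (real p + 1 / 2)..w k * (real p + 1)}"
    if "c \<in> J k" "p < m k" for k c p
    unfolding ch_def by (rule someI_ex) (use child[OF that] in blast)
  define B :: "nat \<Rightarrow> nat \<Rightarrow> nat" where "B = rec_nat (\<lambda>_. c\<^sub>0) (\<lambda>k Bk n. ch k (Bk (n div m k)) (n mod m k))"
  have B_0: "B 0 n = c\<^sub>0" and B_Suc: "B (Suc k) n = ch k (B k (n div m k)) (n mod m k)" for k n
    by (simp_all add: B_def)
  have m_pos: "0 < m k" for k using m[of k] by simp
  have B_J: "B k n \<in> J k" for k n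
  proof (induction k arbitrary: n)
    case (Suc k)
    have "n mod m k < m k" using m_pos[of k] by simp
    from ch[OF Suc this] show ?case unfolding B_Suc by blast
  qed (simp add: B_0 c0)
  define \<phi> where "\<phi> k t = nat \<lfloor>t * M k\<rfloor>" for k and t :: real
  have \<phi>_div: "\<phi> (Suc k) t div m k = \<phi> k t" if "0 \<le> t" for k t
  proof -
    have "\<lfloor>t * M (Suc k)\<rfloor> div int (m k) = \<lfloor>t * M (Suc k) / real_of_int (int (m k))\<rfloor>"
      by (rule floor_divide_real_eq_div[symmetric]) simp
    also have "t * M (Suc k) / real_of_int (int (m k)) = t * M k"
      using m_pos[of k] by (simp add: M_Suc)
    finally show ?thesis
      using that M_pos[of "Suc k"] by (simp add: \<phi>_def nat_div_as_int)
  qed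
  define b where "b t k = B k (\<phi> k t)" for t k
  define p where "p t k = \<phi> (Suc k) t mod m k" for t k
  have b_Suc: "b t (Suc k) = ch k (b t k) (p t k)" if "0 \<le> t" for t k
    by (simp add: b_def p_def B_Suc \<phi>_div that)
  have p_less: "p t k < m k" for t k using m_pos[of k] by (simp add: p_def)
  have cell: "ell1_nth (g (b t (Suc k))) (b t k) \<in> {w k * (real (p t k) + 1 / 2)..w k * (real (p t k) + 1)}"
    if "0 \<le> t" for t k
    using ch[OF B_J[of k "\<phi> k t"] p_less[of t k], folded b_def, folded b_Suc[OF that]] by blast
  have chain: "0 < ell1_nth (g (b t (Suc k))) (b t k)" if "0 \<le> t" for t k
  proof -
    have "0 < w k * (real (p t k) + 1 / 2)" using w by simp
    also have "\<dots> \<le> ell1_nth (g (b t (Suc k))) (b t k)" using cell[OF that, of k] by simp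
    finally show ?thesis .
  qed
  have "\<exists>x. x \<in> leaves (tree_points l g) \<and> (\<forall>k. \<forall>i<b t k. ell1_nth x i = ell1_nth (g (b t k)) i)"
    if "0 \<le> t" for t
    by (rule chain_limit_leaf[where b = "b t", OF \<open>summable l\<close> chain[OF that]]) blast
  then obtain z where z: "\<And>t. 0 \<le> t \<Longrightarrow> z t \<in> leaves (tree_points l g)"
    and z_nth: "\<And>t k i. 0 \<le> t \<Longrightarrow> i < b t k \<Longrightarrow> ell1_nth (z t) i = ell1_nth (g (b t k)) i"
    by metis
  have z_cell: "ell1_nth (z t) (b t k) \<in> {w k * (real (p t k) + 1 / 2)..w k * (real (p t k) + 1)}"
    if "0 \<le> t" for t k
  proof -
    have "b t k < b t (Suc k)"
      using chain[OF that, of k] g_beyond[of "b t (Suc k)" "b t k"] by (metis less_irrefl not_le)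
    then show ?thesis using z_nth[OF that] cell[OF that, of k] by simp
  qed
  have holder: "\<bar>t - t'\<bar> \<le> 4 * C * dist (z t) (z t') powr s" if t: "t \<in> {0..<1}" "t' \<in> {0..<1}" "t < t'" for t t'
  proof -
    have t0: "0 \<le> t" "0 \<le> t'" using t by auto
    have "\<exists>n. \<phi> n t \<noteq> \<phi> n t'"
    proof -
      obtain n where "1 / (t' - t) < 2 ^ n" using real_arch_pow[of 2 "1 / (t' - t)"] by auto
      then have "1 / (t' - t) < M n" using M_ge[of n] by linarith
      then have "t * M n + 1 < t' * M n" using t by (simp add: field_simps)
      then have "\<lfloor>t * M n\<rfloor> < \<lfloor>t' * M n\<rfloor>" by linarith
      moreover have "0 \<le> \<lfloor>t * M n\<rfloor>" using t M_pos[of n] by simp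
      ultimately have "\<phi> n t \<noteq> \<phi> n t'" unfolding \<phi>_def by linarith
      then show ?thesis by blast
    qed
    moreover have "\<phi> 0 t = \<phi> 0 t'"
      using t by (simp add: \<phi>_def M_def floor_eq_iff)
    ultimately obtain k where k: "\<phi> k t = \<phi> k t'" "\<phi> (Suc k) t \<noteq> \<phi> (Suc k) t'"
      using exists_least_lemma[of "\<lambda>n. \<phi> n t \<noteq> \<phi> n t'"] by auto
    have same: "b t k = b t' k" by (simp add: b_def k)
    have \<phi>p: "\<phi> (Suc k) t = \<phi> k t * m k + p t k" "\<phi> (Suc k) t' = \<phi> k t * m k + p t' k"
      using \<phi>_div[of t k] \<phi>_div[of t' k] t0 k(1)
      by (metis p_def div_mult_mod_eq)+
    define q where "q = \<bar>real (p t k) - real (p t' k)\<bar>"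
    have q: "1 \<le> q" "q \<le> real (m k)"
      using k(2) \<phi>p p_less[of t k] p_less[of t' k] by (auto simp: q_def)
    have "\<bar>t * M (Suc k) - t' * M (Suc k)\<bar> \<le> q + 1"
    proof -
      have "of_int \<lfloor>t * M (Suc k)\<rfloor> = real (\<phi> (Suc k) t)" "of_int \<lfloor>t' * M (Suc k)\<rfloor> = real (\<phi> (Suc k) t')"
        using t0 M_pos[of "Suc k"] by (simp_all add: \<phi>_def)
      then have "t * M (Suc k) \<in> {real (\<phi> (Suc k) t)..real (\<phi> (Suc k) t) + 1}"
        "t' * M (Suc k) \<in> {real (\<phi> (Suc k) t')..real (\<phi> (Suc k) t') + 1}"
        by (simp_all only: atLeastAtMost_iff) linarith+
      then show ?thesis unfolding \<phi>p q_def by auto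
    qed
    also have "\<dots> \<le> 2 * q" using q by simp
    finally have "\<bar>t - t'\<bar> * M (Suc k) \<le> 2 * q"
      using M_pos[of "Suc k"] by (simp add: abs_mult left_diff_distrib[symmetric])
    then have "\<bar>t - t'\<bar> \<le> 2 * q / (M k * real (m k))"
      using M_pos[of "Suc k"] by (simp add: M_Suc pos_le_divide_eq)
    also have "\<dots> \<le> 2 * q / (M k * real (m k)) * (C * M k * (real (m k) * w k) powr s)"
    proof -
      have "0 \<le> 2 * q / (M k * real (m k))" using q M_pos[of k] by simp
      from mult_left_mono[OF C[of k, folded M_def] this] show ?thesis by simp
    qed
    also have "\<dots> = 2 * C * w k powr s * (q / real (m k) * real (m k) powr s)"
      using M_pos[of k] m_pos[of k] w[of k] by (simp add: powr_mult field_simps)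
    also have "\<dots> \<le> 2 * C * w k powr s * (q powr s)"
    proof -
      have "q / real (m k) \<le> (q / real (m k)) powr s"
        using powr_mono'[of s 1 "q / real (m k)"] q m_pos[of k] s by simp
      then have "q / real (m k) * real (m k) powr s \<le> q powr s"
        using q m_pos[of k] by (simp add: powr_divide pos_le_divide_eq)
      then show ?thesis using \<open>0 < C\<close> by (intro mult_left_mono) auto
    qed
    also have "\<dots> \<le> 4 * C * (w k * q / 2) powr s"
    proof -
      have "(2::real) powr s \<le> 2" using s powr_mono[of s 1 2] by simp
      then have "2 * C * w k powr s * q powr s * 2 powr s \<le> 2 * C * w k powr s * q powr s * 2"
        using \<open>0 < C\<close> by (intro mult_left_mono) auto
      then show ?thesis
        using w[of k] q by (simp add: powr_mult powr_divide pos_le_divide_eq mult_ac)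
    qed
    also have "\<dots> \<le> 4 * C * dist (z t) (z t') powr s"
    proof -
      have "w k * q / 2 \<le> w k * (q - 1 / 2)"
        using q w[of k] by (simp add: field_simps)
      also have "\<dots> \<le> \<bar>ell1_nth (z t) (b t k) - ell1_nth (z t') (b t k)\<bar>"
        using z_cell[OF t0(1), of k] z_cell[OF t0(2), of k] unfolding same q_def
        by (auto simp: algebra_simps abs_if)
      also have "\<dots> \<le> dist (z t) (z t')" by (rule abs_ell1_nth_diff_le_dist)
      finally show ?thesis using w[of k] q s \<open>0 < C\<close> by (intro mult_left_mono powr_mono2) auto
    qed
    finally show ?thesis .
  qed
  show ?thesis
  proof (rule that)
    fix t t' :: real assume t: "t \<in> {0..<1}" "t' \<in> {0..<1}"
    then show "z t \<in> leaves (tree_points l g)" by (intro z) simp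
    show "\<bar>t - t'\<bar> \<le> 4 * C * dist (z t) (z t') powr s"
      using holder[of t t'] holder[of t' t] t \<open>0 < C\<close>
      by (cases t t' rule: linorder_cases) (auto simp: dist_commute abs_minus_commute)
  qed
qed

section \<open>The uniform measure on a finite tree\<close>

lemma borel_branch_preimage:
  assumes "B \<in> sets borel"
  shows "{x \<in> {0..r}. branch_point u i x \<in> B} \<in> sets lborel"
proof -
  have "branch_point u i \<in> borel_measurable borel"
    unfolding branch_point_def by (intro borel_measurable_continuous_onI continuous_intros)
  then have "branch_point u i -` B \<in> sets borel"
    using measurable_sets[of "branch_point u i" borel borel B] assms by simp
  moreover have "{x \<in> {0..r}. branch_point u i x \<in> B} = {0..r} \<inter> branch_point u i -` B" by auto
  ultimately show ?thesis by simp
qed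

lemma Icc_fmeasurable_lborel: "{x..y::real} \<in> fmeasurable lborel"
  by (cases "x \<le> y") (auto simp: fmeasurable_def)

lemma sets_tree_length_measure [simp]: "sets (tree_length_measure a u n) = sets borel"
  and space_tree_length_measure [simp]: "space (tree_length_measure a u n) = UNIV"
proof -
  have "sets (borel :: ell1 measure) \<subseteq> Pow UNIV" by auto
  then show "sets (tree_length_measure a u n) = sets borel"
    unfolding tree_length_measure_def
    by (simp add: sets_measure_of sigma_algebra.sigma_sets_eq[of UNIV "sets borel"]
        sets.sigma_algebra_axioms[of "borel :: ell1 measure", simplified])
  show "space (tree_length_measure a u n) = UNIV"
    unfolding tree_length_measure_def by (simp add: space_measure_of)
qed

lemma emeasure_tree_length_measure:
  assumes "B \<in> sets borel"
  shows "emeasure (tree_length_measure a u n) B =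
    (\<Sum>i=1..n. emeasure lborel {x \<in> {0..a i}. branch_point u i x \<in> B})"
proof (rule emeasure_measure_of[OF tree_length_measure_def])
  let ?f = "\<lambda>B. \<Sum>i=1..n. emeasure lborel {x \<in> {0..a i}. branch_point u i x \<in> B}"
  show "positive (sets (tree_length_measure a u n)) ?f"
    by (simp add: positive_def)
  show "countably_additive (sets (tree_length_measure a u n)) ?f"
  proof (rule countably_additiveI)
    fix A :: "nat \<Rightarrow> ell1 set"
    assume A: "range A \<subseteq> sets (tree_length_measure a u n)" "disjoint_family A"
    have "(\<Sum>j. ?f (A j)) = (\<Sum>i=1..n. \<Sum>j. emeasure lborel {x \<in> {0..a i}. branch_point u i x \<in> A j})"
      by (rule suminf_sum) auto
    also have "\<dots> = (\<Sum>i=1..n. emeasure lborel (\<Union>j. {x \<in> {0..a i}. branch_point u i x \<in> A j}))"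
    proof (intro sum.cong refl suminf_emeasure)
      fix i
      show "range (\<lambda>j. {x \<in> {0..a i}. branch_point u i x \<in> A j}) \<subseteq> sets lborel"
        using A(1) borel_branch_preimage[of _ "a i" u i] by (auto simp: subset_iff)
      show "disjoint_family (\<lambda>j. {x \<in> {0..a i}. branch_point u i x \<in> A j})"
        using A(2) by (auto simp: disjoint_family_on_def)
    qed
    also have "\<dots> = ?f (\<Union>j. A j)"
      by (intro sum.cong refl arg_cong[where f = "emeasure lborel"]) auto
    finally show "(\<Sum>j. ?f (A j)) = ?f (\<Union>j. A j)" .
  qed
qed (use assms in auto)

lemma finite_tree_borel: "finite_tree a u n \<in> sets borel"
proof -
  have "compact (finite_tree a u n)"
    unfolding finite_tree_def branch_point_def
    by (intro compact_UN compact_continuous_image continuous_intros) auto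
  then show ?thesis by (simp add: compact_imp_closed)
qed

lemma emeasure_branch_preimage_finite:
  "emeasure lborel {x \<in> {0..r}. branch_point u i x \<in> B} \<noteq> \<infinity>"
proof -
  have "emeasure lborel {x \<in> {0..r}. branch_point u i x \<in> B} \<le> emeasure lborel {0..r}"
    by (rule emeasure_mono) auto
  also have "\<dots> < \<infinity>" by (cases "0 \<le> r") auto
  finally show ?thesis by simp
qed

lemma measure_tree_length_measure:
  assumes "B \<in> sets borel"
  shows "measure (tree_length_measure a u n) B =
    (\<Sum>c<n. measure lborel {x \<in> {0..a (Suc c)}. branch_start u c + x *\<^sub>R unit_ell1 c \<in> B})"
proof -
  have "measure (tree_length_measure a u n) B =
      (\<Sum>i=1..n. measure lborel {x \<in> {0..a i}. branch_point u i x \<in> B})"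
    unfolding measure_def emeasure_tree_length_measure[OF assms]
    using emeasure_branch_preimage_finite by (subst enn2real_sum) (auto simp: top.not_eq_extremum)
  also have "\<dots> = (\<Sum>c<n. measure lborel {x \<in> {0..a (Suc c)}. branch_point u (Suc c) x \<in> B})"
    by (simp add: sum.atLeast1_atMost_eq)
  finally show ?thesis by (simp add: branch_point_Suc)
qed

lemma measure_tree_uniform:
  assumes a: "\<And>i. 1 \<le> i \<Longrightarrow> 0 < a i" and "1 \<le> n" and B: "B \<in> sets borel"
  shows "measure (tree_uniform a u n) B =
    (\<Sum>c<n. measure lborel {x \<in> {0..a (Suc c)}. branch_start u c + x *\<^sub>R unit_ell1 c \<in> B}) /
    (\<Sum>c<n. a (Suc c))"
proof -
  let ?\<mu> = "tree_length_measure a u n" and ?T = "finite_tree a u n"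
  have in_T: "branch_start u c + x *\<^sub>R unit_ell1 c \<in> ?T" if "c < n" "x \<in> {0..a (Suc c)}" for c x
    unfolding finite_tree_def branch_point_Suc[symmetric] using that by (auto intro!: bexI[of _ "Suc c"])
  have T: "measure ?\<mu> (?T \<inter> B) =
    (\<Sum>c<n. measure lborel {x \<in> {0..a (Suc c)}. branch_start u c + x *\<^sub>R unit_ell1 c \<in> B})"
    if "B \<in> sets borel" for B
    using that finite_tree_borel in_T
    by (subst measure_tree_length_measure) (auto intro!: sum.cong arg_cong[where f = "measure lborel"])
  have "measure ?\<mu> ?T = (\<Sum>c<n. a (Suc c))"
    using T[of UNIV] a by (simp add: less_imp_le del: atLeastAtMost_iff)
  moreover have "0 < (\<Sum>c<n. a (Suc c))"
    using a \<open>1 \<le> n\<close> by (intro sum_pos) (auto simp: lessThan_empty_iff bot_nat_def)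
  ultimately have "emeasure ?\<mu> ?T \<noteq> 0" by (auto simp: measure_def)
  moreover have "emeasure ?\<mu> ?T \<noteq> \<infinity>"
    unfolding emeasure_tree_length_measure[OF finite_tree_borel]
    using emeasure_branch_preimage_finite by simp
  ultimately have "measure (tree_uniform a u n) B = measure ?\<mu> (?T \<inter> B) / measure ?\<mu> ?T"
    unfolding tree_uniform_def using finite_tree_borel B by (intro measure_uniform_measure) auto
  then show ?thesis using T[OF B] \<open>measure ?\<mu> ?T = _\<close> by simp
qed

text \<open>The points of branch \<open>c + 1\<close>, other than its starting point, have \<open>c\<close> as the last index
  of a nonzero coordinate.\<close>

definition last_coord_in :: "nat \<Rightarrow> real set \<Rightarrow> ell1 set"
  where "last_coord_in c I = {x. ell1_nth x c \<in> I \<and> (\<forall>e>c. ell1_nth x e = 0)}"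

lemma last_coord_in_borel [measurable]:
  assumes [measurable]: "I \<in> sets borel"
  shows "last_coord_in c I \<in> sets borel"
proof -
  have "last_coord_in c I = {x \<in> space borel. ell1_nth x c \<in> I \<and> (\<forall>e\<in>{c<..}. ell1_nth x e = 0)}"
    by (auto simp: last_coord_in_def)
  also have "\<dots> \<in> sets borel" by measurable
  finally show ?thesis .
qed

context
  fixes a :: "nat \<Rightarrow> real" and u :: "nat \<Rightarrow> ell1" and n :: nat
  assumes a_pos: "\<And>i. 1 \<le> i \<Longrightarrow> 0 < a i" and n_pos: "1 \<le> n"
    and in_tree: "\<And>c. c < n \<Longrightarrow> branch_start u c \<in> tree_points_upto (\<lambda>c. a (Suc c)) (branch_start u) c"
begin

lemma sum_branch_lengths_pos: "0 < (\<Sum>c<n. a (Suc c))"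
  using a_pos n_pos by (intro sum_pos) (auto simp: lessThan_empty_iff bot_nat_def)

lemma branch_start_beyond: "c < n \<Longrightarrow> c \<le> e \<Longrightarrow> ell1_nth (branch_start u c) e = 0"
  using in_tree by (simp add: tree_points_upto_def)

lemma measure_tree_uniform_disjoint:
  assumes "B \<in> sets borel" and "B \<inter> tree_points_upto (\<lambda>c. a (Suc c)) (branch_start u) n = {}"
  shows "measure (tree_uniform a u n) B = 0"
proof -
  have empty: "{x \<in> {0..a (Suc c)}. branch_start u c + x *\<^sub>R unit_ell1 c \<in> B} = {}" if "c < n" for c
    using branch_in_tree_points_upto[of "branch_start u" c "\<lambda>c. a (Suc c)" _ n, OF in_tree[OF that] _ _ that]
      assms(2) by (auto simp del: ell1_nth_simps)
  then have "(\<Sum>c<n. measure lborel {x \<in> {0..a (Suc c)}. branch_start u c + x *\<^sub>R unit_ell1 c \<in> B}) = 0"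
    by (intro sum.neutral ballI) (simp only: lessThan_iff measure_empty)
  then show ?thesis
    by (subst measure_tree_uniform[OF a_pos n_pos assms(1)]) simp_all
qed

text \<open>Only branch \<open>c + 1\<close> contributes: on the earlier ones coordinate \<open>c\<close> vanishes, and on a later one its own
  coordinate is nonzero except at the starting point. The total length is at least that of
  the first branch.\<close>

lemma measure_tree_uniform_branch_le:
  assumes "c < n"
  shows "measure (tree_uniform a u n) (last_coord_in c (- {0})) \<le> a (Suc c) / a (Suc 0)"
proof -
  let ?m = "\<lambda>b. measure lborel {x \<in> {0..a (Suc b)}. branch_start u b + x *\<^sub>R unit_ell1 b \<in> last_coord_in c (- {0})}"
  have "?m b \<le> (if b = c then a (Suc c) else 0)" if "b < n" for b
  proof -
    consider "b < c" | "b = c" | "c < b" by linarith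
    then show ?thesis
    proof cases
      case 1
      then have "{x \<in> {0..a (Suc b)}. branch_start u b + x *\<^sub>R unit_ell1 b \<in> last_coord_in c (- {0})} = {}"
        using branch_start_beyond[OF that, of c] by (auto simp: last_coord_in_def)
      then have "?m b = 0" by (simp only: measure_empty)
      then show ?thesis using 1 by simp
    next
      case 2
      have "?m b \<le> measure lborel {0..a (Suc b)}"
        using borel_branch_preimage[of "last_coord_in c (- {0})" "a (Suc b)" u "Suc b"]
        by (intro measure_mono_fmeasurable) (auto simp: branch_point_Suc Icc_fmeasurable_lborel)
      then show ?thesis using 2 a_pos[of "Suc b"] by simp
    next
      case 3
      have sub: "{x \<in> {0..a (Suc b)}. branch_start u b + x *\<^sub>R unit_ell1 b \<in> last_coord_in c (- {0})} \<subseteq> {0}"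
      proof safe
        fix x assume "branch_start u b + x *\<^sub>R unit_ell1 b \<in> last_coord_in c (- {0})"
        then have "ell1_nth (branch_start u b + x *\<^sub>R unit_ell1 b) b = 0"
          using 3 by (auto simp: last_coord_in_def)
        then show "x = 0" using branch_start_beyond[OF that, of b] by simp
      qed
      have "?m b \<le> measure lborel {0::real}"
        using sub borel_branch_preimage[of "last_coord_in c (- {0})" "a (Suc b)" u "Suc b"]
        by (intro measure_mono_fmeasurable) (auto simp: branch_point_Suc fmeasurable_def)
      then show ?thesis using 3 by simp
    qed
  qed
  then have "(\<Sum>b<n. ?m b) \<le> (\<Sum>b<n. if b = c then a (Suc c) else 0)"
    by (intro sum_mono) auto
  also have "\<dots> = a (Suc c)" using assms by simp
  finally have "(\<Sum>b<n. ?m b) \<le> a (Suc c)" .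
  moreover have "a (Suc 0) \<le> (\<Sum>b<n. a (Suc b))"
    using a_pos n_pos member_le_sum[of 0 "{..<n}" "\<lambda>b. a (Suc b)"] by (force simp: less_imp_le)
  ultimately show ?thesis
    using a_pos[of 1] a_pos[of "Suc c"]
    by (subst measure_tree_uniform[OF a_pos n_pos]) (auto intro!: frac_le simp: less_imp_le)
qed

lemma measure_tree_uniform_avoid_le:
  assumes "c < n" and I: "0 \<le> p" "p \<le> q" "q \<le> a (Suc c)" and A: "(\<Sum>b<n. a (Suc b)) \<le> A"
  shows "measure (tree_uniform a u n) (- last_coord_in c {p..q}) \<le> 1 - (q - p) / A"
proof -
  let ?S = "\<lambda>b. {x \<in> {0..a (Suc b)}. branch_start u b + x *\<^sub>R unit_ell1 b \<in> - last_coord_in c {p..q}}"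
  have S: "?S b \<in> sets lborel" for b
    using borel_branch_preimage[of "- last_coord_in c {p..q}" "a (Suc b)" u "Suc b"]
    by (simp add: branch_point_Suc borel_comp)
  have "measure lborel (?S b) \<le> (if b = c then a (Suc b) - (q - p) else a (Suc b))" if "b < n" for b
  proof (cases "b = c")
    case True
    have "?S b \<subseteq> {0..a (Suc b)} - {p..q}"
      using branch_start_beyond[OF that] True by (auto simp: last_coord_in_def)
    then have "measure lborel (?S b) \<le> measure lborel ({0..a (Suc b)} - {p..q})"
      using S by (intro measure_mono_fmeasurable fmeasurable_Diff) (auto simp: Icc_fmeasurable_lborel)
    also have "\<dots> = a (Suc b) - (q - p)"
      using I True by (subst measure_Diff) (auto simp: less_imp_le[OF a_pos])
    finally show ?thesis using True by simp
  next
    case False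
    have "measure lborel (?S b) \<le> measure lborel {0..a (Suc b)}"
      using S by (intro measure_mono_fmeasurable) (auto simp: Icc_fmeasurable_lborel)
    then show ?thesis using False a_pos[of "Suc b"] by simp
  qed
  then have "(\<Sum>b<n. measure lborel (?S b)) \<le> (\<Sum>b<n. if b = c then a (Suc b) - (q - p) else a (Suc b))"
    by (intro sum_mono) auto
  also have "\<dots> = (\<Sum>b<n. a (Suc b) - (if b = c then q - p else 0))"
    by (intro sum.cong) auto
  also have "\<dots> = (\<Sum>b<n. a (Suc b)) - (q - p)"
    using \<open>c < n\<close> by (simp add: sum_subtractf)
  finally have "(\<Sum>b<n. measure lborel (?S b)) / (\<Sum>b<n. a (Suc b))
      \<le> ((\<Sum>b<n. a (Suc b)) - (q - p)) / (\<Sum>b<n. a (Suc b))"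
    using sum_branch_lengths_pos by (intro divide_right_mono) auto
  also have "\<dots> = 1 - (q - p) / (\<Sum>b<n. a (Suc b))"
    using sum_branch_lengths_pos by (simp add: diff_divide_distrib)
  also have "\<dots> \<le> 1 - (q - p) / A"
    using sum_branch_lengths_pos A I by (intro diff_left_mono frac_le) auto
  finally show ?thesis
    by (subst measure_tree_uniform[OF a_pos n_pos]) (auto simp: borel_comp)
qed

end

section \<open>Conditioning on the past\<close>

context tree_aggregation
begin

lemma glue_history_space [simp]: "space (glue_history M U n) = space M"
  and glue_history_sets: "sets (glue_history M U n) =
    sigma_sets (space M) {U k -` B \<inter> space M |k B. 1 \<le> k \<and> k < n \<and> B \<in> sets borel}"
proof -
  have "{U k -` B \<inter> space M |k B. 1 \<le> k \<and> k < n \<and> B \<in> sets borel} \<subseteq> Pow (space M)" by auto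
  then show "space (glue_history M U n) = space M"
    "sets (glue_history M U n) =
      sigma_sets (space M) {U k -` B \<inter> space M |k B. 1 \<le> k \<and> k < n \<and> B \<in> sets borel}"
    by (simp_all add: glue_history_def space_measure_of sets_measure_of)
qed

lemma glue_event_in_history:
  assumes "1 \<le> k" "k < n" "B \<in> sets borel"
  shows "{\<omega> \<in> space M. U k \<omega> \<in> B} \<in> sets (glue_history M U n)"
proof -
  have "{\<omega> \<in> space M. U k \<omega> \<in> B} = U k -` B \<inter> space M" by auto
  then show ?thesis unfolding glue_history_sets using assms by (intro sigma_sets.Basic) blast
qed

lemma sigma_finite_glue_history: "sigma_finite_subalgebra M (glue_history M U n)"
proof (rule finite_measure_subalgebra_is_sigma_finite)
  have "subalgebra M (glue_history M U n)"
    unfolding subalgebra_def glue_history_sets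
    using measurable_sets[OF measurable_glue_point]
    by (auto intro!: sets.sigma_sets_subset)
  then show "finite_measure_subalgebra M (glue_history M U n)"
    by unfold_locales
qed

lemma prob_history_glue:
  assumes n: "1 \<le> n" and B: "B \<in> sets borel" and H: "H \<in> sets (glue_history M U n)"
  shows "prob (H \<inter> {\<omega> \<in> space M. U n \<omega> \<in> B}) =
      (\<integral>\<omega>. indicator H \<omega> * real_cond_exp M (glue_history M U n) (\<lambda>\<omega>. indicator B (U n \<omega>)) \<omega> \<partial>M)"
    and "integrable M (\<lambda>\<omega>. indicator H \<omega> *
      real_cond_exp M (glue_history M U n) (\<lambda>\<omega>. indicator B (U n \<omega>)) \<omega>)"
proof -
  interpret F: sigma_finite_subalgebra M "glue_history M U n" by (rule sigma_finite_glue_history)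
  have [measurable]: "U n \<in> borel_measurable M" using n by (rule measurable_glue_point)
  have [measurable]: "B \<in> sets borel" by fact
  have HM [measurable]: "H \<in> sets M" using H F.subalg by (auto simp: subalgebra_def)
  have int: "integrable M (\<lambda>\<omega>. indicator H \<omega> * (indicator B (U n \<omega>) :: real))"
    by (rule integrable_const_bound[of _ 1]) (auto simp: indicator_def)
  note * = F.real_cond_exp_intg[of "indicator H" "\<lambda>\<omega>. indicator B (U n \<omega>)", OF int]
  show "integrable M (\<lambda>\<omega>. indicator H \<omega> *
      real_cond_exp M (glue_history M U n) (\<lambda>\<omega>. indicator B (U n \<omega>)) \<omega>)"
    using H by (intro *) auto
  have "prob (H \<inter> {\<omega> \<in> space M. U n \<omega> \<in> B}) = (\<integral>\<omega>. indicator (H \<inter> {\<omega> \<in> space M. U n \<omega> \<in> B}) \<omega> \<partial>M)"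
    by simp
  also have "\<dots> = (\<integral>\<omega>. indicator H \<omega> * indicator B (U n \<omega>) \<partial>M)"
    by (intro Bochner_Integration.integral_cong) (auto simp: indicator_def)
  also have "\<dots> = (\<integral>\<omega>. indicator H \<omega> * real_cond_exp M (glue_history M U n) (\<lambda>\<omega>. indicator B (U n \<omega>)) \<omega> \<partial>M)"
    using H by (intro *(2)[symmetric]) auto
  finally show "prob (H \<inter> {\<omega> \<in> space M. U n \<omega> \<in> B}) = \<dots>" .
qed

text \<open>The event that the conditional probability vanishes belongs to the past, and integrating over it
  gives \<open>0\<close>.\<close>

lemma AE_glue_avoids_null:
  assumes n: "1 \<le> n" and B: "B \<in> sets borel"
  shows "AE \<omega> in M. measure (tree_uniform a (\<lambda>k. U k \<omega>) n) B = 0 \<longrightarrow> U n \<omega> \<notin> B"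
proof -
  interpret F: sigma_finite_subalgebra M "glue_history M U n" by (rule sigma_finite_glue_history)
  define r where "r = real_cond_exp M (glue_history M U n) (\<lambda>\<omega>. indicator B (U n \<omega>))"
  have r [measurable]: "r \<in> borel_measurable (glue_history M U n)"
    by (simp add: r_def)
  define H where "H = {\<omega> \<in> space M. r \<omega> \<le> 0}"
  have "{\<omega> \<in> space (glue_history M U n). r \<omega> \<le> 0} \<in> sets (glue_history M U n)" by measurable
  then have H: "H \<in> sets (glue_history M U n)" by (simp add: H_def)
  then have HM: "H \<in> sets M" using F.subalg by (auto simp: subalgebra_def)
  have "prob (H \<inter> {\<omega> \<in> space M. U n \<omega> \<in> B}) = (\<integral>\<omega>. indicator H \<omega> * r \<omega> \<partial>M)"
    unfolding r_def by (rule prob_history_glue(1)[OF n B H])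
  also have "\<dots> \<le> (\<integral>\<omega>. 0 \<partial>M)"
    using prob_history_glue(2)[OF n B H] unfolding r_def[symmetric]
    by (intro integral_mono) (auto simp: H_def indicator_def)
  finally have "prob (H \<inter> {\<omega> \<in> space M. U n \<omega> \<in> B}) = 0"
    by (simp add: measure_le_0_iff)
  moreover have "{\<omega> \<in> space M. U n \<omega> \<in> B} \<in> sets M"
    using measurable_sets[OF measurable_glue_point[OF n] B] by (simp add: vimage_def Int_def conj_commute)
  ultimately have "AE \<omega> in M. \<omega> \<notin> H \<inter> {\<omega> \<in> space M. U n \<omega> \<in> B}"
    using HM by (subst (asm) prob_eq_0) auto
  with uniform_glue_point[OF n B] AE_space show ?thesis
    by eventually_elim (auto simp: H_def r_def)
qed

text \<open>The law of \<open>U n\<close> given the past is known for one fixed Borel set at a time, whereas the tree is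
  random. However, a point outside the tree lies in one of countably many fixed open sets that
  miss the tree: a coordinate is out of range or beyond the present branches, or it is nonzero while an earlier coordinate is separated by
  a rational number from the one of the gluing point.\<close>

lemma AE_glue_points_in_tree:
  assumes a: "\<And>i. 1 \<le> i \<Longrightarrow> 0 < a i"
  shows "AE \<omega> in M. \<forall>n. branch_start (\<lambda>k. U k \<omega>) n \<in>
    tree_points_upto (\<lambda>c. a (Suc c)) (branch_start (\<lambda>k. U k \<omega>)) n"
proof -
  define N :: "ell1 set set" where "N =
    (\<Union>j. {{x. ell1_nth x j < 0}, {x. a (Suc j) < ell1_nth x j}, {x. ell1_nth x j \<noteq> 0}}) \<union>
    (\<Union>j. \<Union>i. \<Union>q\<in>\<rat>. {{x. ell1_nth x j \<noteq> 0 \<and> ell1_nth x i < q},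
                    {x. ell1_nth x j \<noteq> 0 \<and> q < ell1_nth x i}})"
  have "countable N"
    unfolding N_def by (intro countable_Un countable_UN countable_rat) auto
  have N_open: "open B" if "B \<in> N" for B
    using that unfolding N_def
    by (auto intro!: open_Collect_less open_Collect_neq open_Collect_conj continuous_intros)
  have "AE \<omega> in M. \<forall>B\<in>N. \<forall>n\<in>{1..}. measure (tree_uniform a (\<lambda>k. U k \<omega>) n) B = 0 \<longrightarrow> U n \<omega> \<notin> B"
    using \<open>countable N\<close> N_open AE_glue_avoids_null by (simp add: AE_ball_countable)
  then show ?thesis
  proof eventually_elim
    fix \<omega> assume avoid: "\<forall>B\<in>N. \<forall>n\<in>{1..}. measure (tree_uniform a (\<lambda>k. U k \<omega>) n) B = 0 \<longrightarrow> U n \<omega> \<notin> B"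
    let ?l = "\<lambda>c. a (Suc c)" and ?g = "branch_start (\<lambda>k. U k \<omega>)"
    show "\<forall>n. ?g n \<in> tree_points_upto ?l ?g n"
    proof
      fix n
      show "?g n \<in> tree_points_upto ?l ?g n"
      proof (induction n rule: less_induct)
        case (less n)
        show ?case
        proof (cases "n = 0")
          case True
          then show ?thesis using a
            by (auto simp: branch_start_def tree_points_upto_def tree_points_def less_imp_le)
        next
          case False
          then have n: "1 \<le> n" by simp
          have out: "?g n \<notin> B" if "B \<in> N" "B \<inter> tree_points_upto ?l ?g n = {}" for B
          proof -
            have "measure (tree_uniform a (\<lambda>k. U k \<omega>) n) B = 0"
              using that a n less N_open by (intro measure_tree_uniform_disjoint) auto
            then show ?thesis using avoid that(1) n by (simp add: branch_start_def)
          qed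
          have upto: "0 \<le> ell1_nth x j" "ell1_nth x j \<le> a (Suc j)" "n \<le> j \<Longrightarrow> ell1_nth x j = 0"
            if "x \<in> tree_points_upto ?l ?g n" for x j
            using that by (simp_all add: tree_points_upto_def tree_points_def)
          have in_N: "{x. ell1_nth x j < 0} \<in> N" "{x. a (Suc j) < ell1_nth x j} \<in> N"
            "{x. ell1_nth x j \<noteq> 0} \<in> N" for j
            unfolding N_def by blast+
          have neg: "\<not> ell1_nth (?g n) j < 0" for j
            using out[OF in_N(1)[of j]] upto(1)[of _ j] by (auto simp: not_less[symmetric])
          have big: "\<not> a (Suc j) < ell1_nth (?g n) j" for j
            using out[OF in_N(2)[of j]] upto(2)[of _ j] by (auto simp: not_less[symmetric])
          have supp: "ell1_nth (?g n) j = 0" if "n \<le> j" for j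
            using out[OF in_N(3)[of j]] upto(3)[OF _ that] by auto
          have tree_prefix: "ell1_nth x i = ell1_nth (?g j) i"
            if "x \<in> tree_points_upto ?l ?g n" "ell1_nth x j \<noteq> 0" "i < j" for x i j
            using that by (intro tree_points_prefix[of x ?l]) (auto simp: tree_points_upto_def)
          have pre: "ell1_nth (?g n) i = ell1_nth (?g j) i"
            if "ell1_nth (?g n) j \<noteq> 0" "i < j" for i j
          proof (rule ccontr)
            assume "ell1_nth (?g n) i \<noteq> ell1_nth (?g j) i"
            then consider "ell1_nth (?g n) i < ell1_nth (?g j) i" | "ell1_nth (?g j) i < ell1_nth (?g n) i"
              by linarith
            then show False
            proof cases
              case 1
              then obtain q where q: "q \<in> \<rat>" "ell1_nth (?g n) i < q" "q < ell1_nth (?g j) i"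
                using Rats_dense_in_real by blast
              let ?B = "{x. ell1_nth x j \<noteq> 0 \<and> ell1_nth x i < q}"
              have "?B \<in> N" using q(1) unfolding N_def by blast
              moreover have "?B \<inter> tree_points_upto ?l ?g n = {}"
                using q(3) tree_prefix[OF _ _ \<open>i < j\<close>] by auto
              ultimately show False using out[of ?B] q(2) that(1) by simp
            next
              case 2
              then obtain q where q: "q \<in> \<rat>" "ell1_nth (?g j) i < q" "q < ell1_nth (?g n) i"
                using Rats_dense_in_real by blast
              let ?B = "{x. ell1_nth x j \<noteq> 0 \<and> q < ell1_nth x i}"
              have "?B \<in> N" using q(1) unfolding N_def by blast
              moreover have "?B \<inter> tree_points_upto ?l ?g n = {}"
                using q(2) tree_prefix[OF _ _ \<open>i < j\<close>] by auto
              ultimately show False using out[of ?B] q(3) that(1) by simp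
            qed
          qed
          show ?thesis
            unfolding tree_points_upto_def tree_points_def
            using neg big supp pre by (simp add: not_less)
        qed
      qed
    qed
  qed
qed

text \<open>Deterministic bounds on the conditional probabilities multiply as for independent events: condition
  on everything before the largest index, and proceed by induction.\<close>

lemma prob_glue_points_le:
  assumes "finite S" and "\<And>n. n \<in> S \<Longrightarrow> 1 \<le> n" and "\<And>n. n \<in> S \<Longrightarrow> B n \<in> sets borel"
    and "\<And>n. n \<in> S \<Longrightarrow> 0 \<le> p n"
    and "\<And>n. n \<in> S \<Longrightarrow> AE \<omega> in M. measure (tree_uniform a (\<lambda>k. U k \<omega>) n) (B n) \<le> p n"
  shows "prob {\<omega> \<in> space M. \<forall>n\<in>S. U n \<omega> \<in> B n} \<le> (\<Prod>n\<in>S. p n)"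
  using assms
proof (induction S rule: finite_linorder_max_induct)
  case empty
  then show ?case by (simp add: prob_space)
next
  case (insert n S)
  define H where "H = {\<omega> \<in> space M. \<forall>k\<in>S. U k \<omega> \<in> B k}"
  have "{\<omega> \<in> space (glue_history M U n). \<forall>k\<in>S. U k \<omega> \<in> B k} \<in> sets (glue_history M U n)"
  proof (rule sets.sets_Collect_finite_All[OF _ insert.hyps(1)])
    fix k assume "k \<in> S"
    then show "{\<omega> \<in> space (glue_history M U n). U k \<omega> \<in> B k} \<in> sets (glue_history M U n)"
      using insert by (simp add: glue_event_in_history)
  qed
  then have H: "H \<in> sets (glue_history M U n)" by (simp add: H_def)
  have HM: "H \<in> sets M"
    using H sigma_finite_glue_history[of n] by (auto simp: sigma_finite_subalgebra_def subalgebra_def)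
  have n: "1 \<le> n" and B: "B n \<in> sets borel" and p: "0 \<le> p n" using insert by auto
  let ?r = "real_cond_exp M (glue_history M U n) (\<lambda>\<omega>. indicator (B n) (U n \<omega>))"
  have "{\<omega> \<in> space M. \<forall>k\<in>insert n S. U k \<omega> \<in> B k} = H \<inter> {\<omega> \<in> space M. U n \<omega> \<in> B n}"
    by (auto simp: H_def)
  then have "prob {\<omega> \<in> space M. \<forall>k\<in>insert n S. U k \<omega> \<in> B k} = (\<integral>\<omega>. indicator H \<omega> * ?r \<omega> \<partial>M)"
    using prob_history_glue(1)[OF n B H] by simp
  also have "\<dots> \<le> (\<integral>\<omega>. indicator H \<omega> * p n \<partial>M)"
  proof (rule integral_mono_AE)
    show "integrable M (\<lambda>\<omega>. indicator H \<omega> * ?r \<omega>)" by (rule prob_history_glue(2)[OF n B H])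
    show "integrable M (\<lambda>\<omega>. indicator H \<omega> * p n)"
      using HM by (intro integrable_mult_left integrable_real_indicator) (auto simp: emeasure_eq_measure)
    have "AE \<omega> in M. measure (tree_uniform a (\<lambda>k. U k \<omega>) n) (B n) \<le> p n" using insert by auto
    with uniform_glue_point[OF n B] show "AE \<omega> in M. indicator H \<omega> * ?r \<omega> \<le> indicator H \<omega> * p n"
      by eventually_elim (auto simp: indicator_def)
  qed
  also have "\<dots> = prob H * p n" using HM by simp
  also have "\<dots> \<le> (\<Prod>k\<in>S. p k) * p n"
    unfolding H_def using insert p by (intro mult_right_mono insert.IH) auto
  also have "\<dots> = (\<Prod>k\<in>insert n S. p k)"
    using insert.hyps by (subst prod.insert) auto
  finally show ?case .
qed

lemma glue_event_measurable:
  assumes "finite S" and "\<And>n. n \<in> S \<Longrightarrow> 1 \<le> n" and "\<And>n. n \<in> S \<Longrightarrow> B n \<in> sets borel"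
  shows "{\<omega> \<in> space M. \<forall>n\<in>S. U n \<omega> \<in> B n} \<in> sets M"
proof (rule sets.sets_Collect_finite_All[OF _ assms(1)])
  fix n assume "n \<in> S"
  have "{\<omega> \<in> space M. U n \<omega> \<in> B n} = U n -` B n \<inter> space M" by auto
  then show "{\<omega> \<in> space M. U n \<omega> \<in> B n} \<in> sets M"
    using measurable_sets[OF measurable_glue_point] assms \<open>n \<in> S\<close> by simp
qed

end

section \<open>Distance to the finite trees\<close>

lemma obtain_initial_subset:
  fixes S :: "nat set"
  assumes "finite S" "k \<le> card S"
  obtains e where "card (S \<inter> {..<e}) = k"
proof -
  have "\<exists>e. card (S \<inter> {..<e}) = k"
    using assms(2)
  proof (induction k)
    case 0
    show ?case by (intro exI[of _ 0]) simp
  next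
    case (Suc k)
    then obtain e where e: "card (S \<inter> {..<e}) = k" by auto
    define d where "d = Min (S - {..<e})"
    have "S - {..<e} \<noteq> {}"
    proof
      assume "S - {..<e} = {}"
      then have "S \<inter> {..<e} = S" by auto
      then show False using e Suc.prems by simp
    qed
    then have d: "d \<in> S" "e \<le> d" and min: "\<And>c. c \<in> S \<Longrightarrow> e \<le> c \<Longrightarrow> d \<le> c"
      using Min_in[of "S - {..<e}"] Min_le[of "S - {..<e}"] assms(1) by (auto simp: d_def)
    have "S \<inter> {..<Suc d} = insert d (S \<inter> {..<e})"
      using d min by (auto simp: less_Suc_eq) (metis leD le_less_linear order.strict_trans2)
    then have "card (S \<inter> {..<Suc d}) = Suc k"
      using e d assms(1) by simp
    then show ?case by blast
  qed
  then show ?thesis using that by blast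
qed

text \<open>The coordinates in the block from \<open>2 ^ i * c\<close> to \<open>2 ^ (i + 1) * c\<close> sum up to at most
  \<open>k * (2 ^ i * c) powr - \<beta>\<close>, and these bounds form a geometric series.\<close>

lemma tree_points_tail_le:
  assumes x: "x \<in> tree_points l g" and "0 < \<beta>" and "1 \<le> N"
    and l: "\<And>c. N \<le> c \<Longrightarrow> l c \<le> real c powr - \<beta>"
    and few: "\<And>n. N \<le> n \<Longrightarrow> card {c \<in> {n..<2 * n}. ell1_nth x c \<noteq> 0} \<le> k"
    and "N \<le> c"
  shows "dist x (ell1_take c x) \<le> real k / (1 - 2 powr - \<beta>) * real c powr - \<beta>"
proof -
  define q :: real where "q = 2 powr - \<beta>"
  have q: "0 < q" "q < 1" using \<open>0 < \<beta>\<close> by (auto simp: q_def powr_less_one)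
  note nn = ell1_nonneg_nth[OF tree_points_nonneg[OF x]]
  have block: "(\<Sum>i=n..<2*n. ell1_nth x i) \<le> real k * real n powr - \<beta>" if "N \<le> n" for n
  proof -
    have "(\<Sum>i=n..<2*n. ell1_nth x i) = (\<Sum>i\<in>{c \<in> {n..<2 * n}. ell1_nth x c \<noteq> 0}. ell1_nth x i)"
      by (rule sum.mono_neutral_right) auto
    also have "\<dots> \<le> (\<Sum>i\<in>{c \<in> {n..<2 * n}. ell1_nth x c \<noteq> 0}. real n powr - \<beta>)"
    proof (rule sum_mono)
      fix i assume "i \<in> {c \<in> {n..<2 * n}. ell1_nth x c \<noteq> 0}"
      then have i: "n \<le> i" by simp
      have "ell1_nth x i \<le> l i" using x by (rule tree_points_le)
      also have "\<dots> \<le> real i powr - \<beta>" using i that by (intro l) simp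
      also have "\<dots> \<le> real n powr - \<beta>"
        using i that \<open>1 \<le> N\<close> \<open>0 < \<beta>\<close> by (intro powr_mono2') auto
      finally show "ell1_nth x i \<le> real n powr - \<beta>" .
    qed
    also have "\<dots> \<le> real k * real n powr - \<beta>"
      using few[OF that] by (simp add: mult_right_mono)
    finally show ?thesis .
  qed
  have sum: "(\<Sum>i=c..<2^j*c. ell1_nth x i) \<le> real k * real c powr - \<beta> * (\<Sum>i<j. q ^ i)" for j
  proof (induction j)
    case (Suc j)
    have "N \<le> 2 ^ j * c" using \<open>N \<le> c\<close> by (metis le_trans mult_le_mono1 nat_mult_1 one_le_numeral one_le_power)
    then have "(\<Sum>i=2^j*c..<2*(2^j*c). ell1_nth x i) \<le> real k * real (2^j*c) powr - \<beta>"
      by (rule block)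
    also have "real (2^j*c) powr - \<beta> = real c powr - \<beta> * q ^ j"
      by (simp add: powr_mult q_def powr_power powr_powr mult.commute flip: powr_realpow)
    finally have "(\<Sum>i=2^j*c..<2^Suc j*c. ell1_nth x i) \<le> real k * real c powr - \<beta> * q ^ j"
      by (simp add: mult_ac)
    moreover have "(\<Sum>i=c..<2^Suc j*c. ell1_nth x i)
      = (\<Sum>i=c..<2^j*c. ell1_nth x i) + (\<Sum>i=2^j*c..<2^Suc j*c. ell1_nth x i)"
      by (rule sum.atLeastLessThan_concat[symmetric]) auto
    ultimately show ?case using Suc by (simp add: distrib_left)
  qed simp
  have "norm (x - ell1_take c x) \<le> real k * real c powr - \<beta> * (1 / (1 - q))"
  proof (rule norm_ell1_le)
    fix n
    have "(\<Sum>i<n. \<bar>ell1_nth (x - ell1_take c x) i\<bar>) = (\<Sum>i\<in>{..<n} - {..<c}. \<bar>ell1_nth (x - ell1_take c x) i\<bar>)"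
      by (rule sum.mono_neutral_right) auto
    also have "\<dots> = (\<Sum>i=c..<n. ell1_nth x i)"
      using nn by (intro sum.cong) auto
    also have "\<dots> \<le> (\<Sum>i=c..<2^n*c. ell1_nth x i)"
    proof (rule sum_mono2)
      have "n \<le> 2 ^ n * c"
        using \<open>1 \<le> N\<close> \<open>N \<le> c\<close> less_exp[of n]
        by (metis le_trans less_imp_le mult_le_mono2 nat_mult_1_right)
      then show "{c..<n} \<subseteq> {c..<2 ^ n * c}" by auto
    qed (use nn in auto)
    also have "\<dots> \<le> real k * real c powr - \<beta> * (\<Sum>i<n. q ^ i)" by (rule sum)
    also have "\<dots> \<le> real k * real c powr - \<beta> * (1 / (1 - q))"
    proof (rule mult_left_mono)
      have "(\<Sum>i<n. q ^ i) \<le> (\<Sum>i. q ^ i)"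
        using q by (intro sum_le_suminf) (auto simp: summable_geometric)
      also have "\<dots> = 1 / (1 - q)" using q by (intro suminf_geometric) auto
      finally show "(\<Sum>i<n. q ^ i) \<le> 1 / (1 - q)" .
    qed simp
    finally show "(\<Sum>i<n. \<bar>ell1_nth (x - ell1_take c x) i\<bar>) \<le> real k * real c powr - \<beta> * (1 / (1 - q))" .
  qed
  then show ?thesis by (simp add: dist_norm q_def mult.commute)
qed

context tree_aggregation
begin

abbreviation (input) "starts \<omega> \<equiv> branch_start (\<lambda>k. U k \<omega>)"
abbreviation (input) "lens \<equiv> (\<lambda>c. a (Suc c))"

text \<open>A point with \<open>k\<close> nonzero coordinates in the block \<open>[n, 2 n)\<close> yields \<open>k\<close> branches of the block each of which
  is glued on the preceding one. For given branches this has probability at most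
  \<open>(n powr - \<beta> / a 1) ^ (k - 1)\<close>, and there are at most \<open>n ^ k\<close> choices. As \<open>\<beta> > 1\<close>, the product of
  the two bounds is summable once \<open>k\<close> is large.\<close>

lemma AE_few_branches_on_path:
  assumes a: "\<And>i. 1 \<le> i \<Longrightarrow> 0 < a i" and "1 < \<beta>"
    and le: "\<And>i. i\<^sub>0 \<le> i \<Longrightarrow> a i \<le> real i powr - \<beta>"
  obtains k where "AE \<omega> in M. \<exists>N. \<forall>n\<ge>N. \<forall>x\<in>tree_points lens (starts \<omega>).
    card {c \<in> {n..<2 * n}. ell1_nth x c \<noteq> 0} \<le> k"
proof -
  obtain k :: nat where k0: "(\<beta> + 2) / (\<beta> - 1) \<le> real k" using real_arch_simple by blast
  then have k: "\<beta> + 2 \<le> real k * (\<beta> - 1)" using \<open>1 < \<beta>\<close> by (simp add: pos_divide_le_eq)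
  have "1 \<le> k"
  proof (rule ccontr)
    assume "\<not> 1 \<le> k"
    then have "k = 0" by simp
    then show False using k \<open>1 < \<beta>\<close> by simp
  qed
  have in_tree: "AE \<omega> in M. \<forall>n. starts \<omega> n \<in> tree_points_upto lens (starts \<omega>) n"
    by (rule AE_glue_points_in_tree) (rule a)
  define pred where "pred C d = Max {c \<in> C. c < d}" for C and d :: nat
  define chain where "chain C = {\<omega> \<in> space M. \<forall>d\<in>C - {Min C}. U d \<omega> \<in> last_coord_in (pred C d) (- {0})}" for C
  define \<C> where "\<C> n = {C. C \<subseteq> {n..<2 * n} \<and> card C = k}" for n :: nat
  define E where "E n = (\<Union>C\<in>\<C> n. chain C)" for n
  have fin: "finite C" if "C \<in> \<C> n" for C n
    using that by (auto simp: \<C>_def intro: finite_subset)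
  have fin\<C>: "finite (\<C> n)" for n unfolding \<C>_def by simp
  have pred: "pred C d \<in> C" "pred C d < d" if "C \<in> \<C> n" "d \<in> C - {Min C}" for C d n
  proof -
    have "Min C \<in> {c \<in> C. c < d}"
      using that fin[OF that(1)] Min_le[of C d] by (auto simp: order_less_le intro: Min_in)
    then have "pred C d \<in> {c \<in> C. c < d}"
      unfolding pred_def using fin[OF that(1)] by (intro Max_in) auto
    then show "pred C d \<in> C" "pred C d < d" by auto
  qed
  have chain_sets: "chain C \<in> sets M" if "C \<in> \<C> n" for C n
    unfolding chain_def
  proof (rule glue_event_measurable)
    fix d assume "d \<in> C - {Min C}"
    then show "1 \<le> d" using pred(2)[OF that] by fastforce
  qed (use fin[OF that] in auto)
  have prob_chain: "prob (chain C) \<le> (real n powr - \<beta> / a 1) ^ (k - 1)"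
    if C: "C \<in> \<C> n" and n: "max 1 i\<^sub>0 \<le> n" for C n
  proof -
    have "prob (chain C) \<le> (\<Prod>d\<in>C - {Min C}. real n powr - \<beta> / a 1)"
      unfolding chain_def
    proof (rule prob_glue_points_le)
      fix d assume d: "d \<in> C - {Min C}"
      note pr = pred[OF C d]
      show "1 \<le> d" using pr(2) by simp
      have "n \<le> pred C d" using pr(1) C by (auto simp: \<C>_def)
      have "a (Suc (pred C d)) \<le> real (Suc (pred C d)) powr - \<beta>"
        using n \<open>n \<le> pred C d\<close> by (intro le) simp
      also have "\<dots> \<le> real n powr - \<beta>"
        using n \<open>n \<le> pred C d\<close> \<open>1 < \<beta>\<close> by (intro powr_mono2') auto
      finally have *: "a (Suc (pred C d)) / a (Suc 0) \<le> real n powr - \<beta> / a 1"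
        using a[of 1] by (simp add: divide_right_mono less_imp_le)
      show "AE \<omega> in M. measure (tree_uniform a (\<lambda>k. U k \<omega>) d) (last_coord_in (pred C d) (- {0})) \<le> real n powr - \<beta> / a 1"
        using in_tree
      proof eventually_elim
        case (elim \<omega>)
        then have "measure (tree_uniform a (\<lambda>k. U k \<omega>) d) (last_coord_in (pred C d) (- {0}))
          \<le> a (Suc (pred C d)) / a (Suc 0)"
          using a pr(2) by (intro measure_tree_uniform_branch_le) auto
        then show ?case using * by (rule order_trans)
      qed
      show "0 \<le> real n powr - \<beta> / a 1" using a[of 1] by simp
    qed (use fin[OF C] in auto)
    also have "\<dots> = (real n powr - \<beta> / a 1) ^ (k - 1)"
    proof -
      have "C \<noteq> {}" using C \<open>1 \<le> k\<close> by (auto simp: \<C>_def)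
      then show ?thesis using fin[OF C] C by (simp add: \<C>_def card_Diff_singleton)
    qed
    finally show ?thesis .
  qed
  have prob_E: "prob (E n) \<le> (1 / a 1) ^ (k - 1) * real n powr - 2" if n: "max 1 i\<^sub>0 \<le> n" for n
  proof -
    have "prob (E n) \<le> (\<Sum>C\<in>\<C> n. prob (chain C))"
      unfolding E_def using chain_sets fin\<C> by (intro finite_measure_subadditive_finite) auto
    also have "\<dots> \<le> real (card (\<C> n)) * (real n powr - \<beta> / a 1) ^ (k - 1)"
      using prob_chain[OF _ n] by (intro sum_bounded_above) auto
    also have "real (card (\<C> n)) \<le> real n ^ k"
    proof -
      have "card (\<C> n) = n choose k"
        unfolding \<C>_def using n_subsets[of "{n..<2 * n}" k] by simp
      also have "\<dots> \<le> n ^ k"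
        by (cases "k \<le> n") (auto simp: binomial_le_pow binomial_eq_0)
      finally show ?thesis by (metis of_nat_le_iff of_nat_power)
    qed
    also have "real n ^ k * (real n powr - \<beta> / a 1) ^ (k - 1)
      = (1 / a 1) ^ (k - 1) * real n powr (real k - \<beta> * (real k - 1))"
    proof -
      have "real n ^ k * (real n powr - \<beta>) ^ (k - 1) = real n powr (real k - \<beta> * (real k - 1))"
        using n \<open>1 \<le> k\<close>
        by (simp add: powr_realpow[symmetric] powr_powr powr_add[symmetric] powr_power of_nat_diff)
      then show ?thesis by (simp add: power_divide)
    qed
    also have "\<dots> \<le> (1 / a 1) ^ (k - 1) * real n powr - 2"
      using n k a[of 1] by (intro mult_left_mono powr_mono) (auto simp: algebra_simps)
    finally show ?thesis using a[of 1] by (simp add: mult_right_mono)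
  qed
  have "AE \<omega> in M. eventually (\<lambda>n. \<omega> \<in> space M - E n) sequentially"
  proof (rule borel_cantelli_AE1)
    show "E n \<in> sets M" for n
      unfolding E_def using chain_sets fin\<C> by (intro sets.finite_UN) auto
    show "emeasure M (E n) < \<infinity>" for n
      by (simp add: emeasure_eq_measure)
    show "summable (\<lambda>n. prob (E n))"
    proof (rule summable_comparison_test')
      show "summable (\<lambda>n. (1 / a 1) ^ (k - 1) * real n powr - 2)"
        by (intro summable_mult) (simp add: summable_real_powr_iff)
      show "norm (prob (E n)) \<le> (1 / a 1) ^ (k - 1) * real n powr - 2" if "n \<ge> max 1 i\<^sub>0" for n
        using prob_E[OF that] by simp
    qed
  qed
  then have "AE \<omega> in M. \<exists>N. \<forall>n\<ge>N. \<forall>x\<in>tree_points lens (starts \<omega>).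
      card {c \<in> {n..<2 * n}. ell1_nth x c \<noteq> 0} \<le> k"
    using in_tree AE_space
  proof eventually_elim
    case (elim \<omega>)
    then obtain N where N: "\<And>n. N \<le> n \<Longrightarrow> \<omega> \<notin> E n"
      by (auto simp: eventually_sequentially)
    have "card {c \<in> {n..<2 * n}. ell1_nth x c \<noteq> 0} \<le> k"
      if "N \<le> n" and x: "x \<in> tree_points lens (starts \<omega>)" for n x
    proof (rule ccontr)
      let ?S = "{c \<in> {n..<2 * n}. ell1_nth x c \<noteq> 0}"
      \<comment> \<open>The first \<open>k\<close> elements of the support are consecutive in it, so each is glued on its predecessor;
        an arbitrary subset of size \<open>k\<close> would not do.\<close>
      assume "\<not> card ?S \<le> k"
      then obtain e where e: "card (?S \<inter> {..<e}) = k"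
        using obtain_initial_subset[of ?S k] by auto
      define C where "C = ?S \<inter> {..<e}"
      have C: "C \<in> \<C> n" using e by (auto simp: C_def \<C>_def)
      have "U d \<omega> \<in> last_coord_in (pred C d) (- {0})" if d: "d \<in> C - {Min C}" for d
      proof -
        note pr = pred[OF C d]
        have Ud: "U d \<omega> = starts \<omega> d" using pr(2) by (simp add: branch_start_def)
        have same: "ell1_nth (U d \<omega>) i = ell1_nth x i" if "i < d" for i
          using tree_points_prefix[OF x _ that] d unfolding Ud by (simp add: C_def)
        have "ell1_nth (U d \<omega>) i = 0" if i: "pred C d < i" for i
        proof (cases "i < d")
          case True
          have "i \<notin> C"
          proof
            assume "i \<in> C"
            then have "i \<le> pred C d"
              unfolding pred_def using True fin[OF C] by (intro Max_ge) auto
            then show False using i by simp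
          qed
          then have "ell1_nth x i = 0"
            using i True pr(1) d by (auto simp: C_def)
          then show ?thesis using same[OF True] by simp
        next
          case False
          have "starts \<omega> d \<in> tree_points_upto lens (starts \<omega>) d" using elim by simp
          then show ?thesis using False unfolding Ud by (simp add: tree_points_upto_def)
        qed
        moreover have "ell1_nth (U d \<omega>) (pred C d) \<noteq> 0"
          using same[OF pr(2)] pr(1) by (simp add: C_def)
        ultimately show ?thesis by (simp add: last_coord_in_def)
      qed
      then have "\<omega> \<in> chain C" using elim by (simp add: chain_def)
      then show False using N[OF \<open>N \<le> n\<close>] C by (auto simp: E_def)
    qed
    then show ?case by blast
  qed
  then show ?thesis by (rule that)
qed

lemma AE_hausdorff_measure_leaves_eq_0:
  assumes a: "\<And>i. 1 \<le> i \<Longrightarrow> 0 < a i" and "1 < \<beta>"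
    and le: "\<And>i. i\<^sub>0 \<le> i \<Longrightarrow> a i \<le> real i powr - \<beta>"
  shows "AE \<omega> in M. \<forall>s>0. 1 < \<beta> * s \<longrightarrow> hausdorff_measure (tree_points lens (starts \<omega>))
    (length_dist (tree_points lens (starts \<omega>))) s (leaves (tree_points lens (starts \<omega>))) = 0"
proof -
  have in_tree: "AE \<omega> in M. \<forall>n. starts \<omega> n \<in> tree_points_upto lens (starts \<omega>) n"
    by (rule AE_glue_points_in_tree) (rule a)
  obtain k where "AE \<omega> in M. \<exists>N. \<forall>n\<ge>N. \<forall>x\<in>tree_points lens (starts \<omega>).
      card {c \<in> {n..<2 * n}. ell1_nth x c \<noteq> 0} \<le> k"
    using AE_few_branches_on_path[OF a \<open>1 < \<beta>\<close> le] by blast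
  then show ?thesis using in_tree
  proof eventually_elim
    case (elim \<omega>)
    then obtain N where N: "\<And>n x. N \<le> n \<Longrightarrow> x \<in> tree_points lens (starts \<omega>) \<Longrightarrow>
        card {c \<in> {n..<2 * n}. ell1_nth x c \<noteq> 0} \<le> k" by blast
    interpret glued_tree lens "starts \<omega>"
      using elim a by unfold_locales auto
    define N' where "N' = max (max 1 i\<^sub>0) N"
    have N': "1 \<le> N'" "i\<^sub>0 \<le> N'" "N \<le> N'" by (auto simp: N'_def)
    have lens: "lens c \<le> real c powr - \<beta>" if "N' \<le> c" for c
    proof -
      have "lens c \<le> real (Suc c) powr - \<beta>" using that N' by (intro le) simp
      also have "\<dots> \<le> real c powr - \<beta>" using that N' \<open>1 < \<beta>\<close> by (intro powr_mono2') auto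
      finally show ?thesis .
    qed
    define K where "K = real (Suc k) / (1 - 2 powr - \<beta>)"
    have "2 powr - \<beta> < 1" using \<open>1 < \<beta>\<close> by (simp add: powr_less_one)
    then have "0 < K" by (simp add: K_def)
    have tail: "dist x (ell1_take c x) \<le> K * real c powr - \<beta>"
      if "x \<in> tree_points lens (starts \<omega>)" "N' \<le> c" for x c
      unfolding K_def using that N N' lens \<open>1 < \<beta>\<close>
      by (intro tree_points_tail_le[where l = lens and g = "starts \<omega>" and N = N']) (auto intro: le_SucI)
    show ?case
      using tail \<open>0 < K\<close> \<open>1 < \<beta>\<close> by (auto intro!: hausdorff_measure_leaves_eq_0)
  qed
qed

end

section \<open>Long branches\<close>

lemma le_powr_o1E:
  assumes "le_powr_o1 a (- \<alpha>)" "\<beta> < \<alpha>"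
  obtains i\<^sub>0 where "\<And>i. i\<^sub>0 \<le> i \<Longrightarrow> a i \<le> real i powr - \<beta>"
proof -
  have "\<forall>\<^sub>F i in sequentially. a i \<le> real i powr (- \<alpha> + (\<alpha> - \<beta>))"
    using assms unfolding le_powr_o1_def by (metis diff_gt_0_iff_gt)
  then show ?thesis using that by (auto simp: eventually_sequentially)
qed

lemma summable_le_powr_o1:
  assumes "\<And>i. 1 \<le> i \<Longrightarrow> 0 < a i" "1 < \<alpha>" "le_powr_o1 a (- \<alpha>)"
  shows "summable (\<lambda>c. a (Suc c))"
proof -
  obtain i\<^sub>0 where i0: "\<And>i. i\<^sub>0 \<le> i \<Longrightarrow> a i \<le> real i powr - ((1 + \<alpha>) / 2)"
    using le_powr_o1E[OF assms(3), of "(1 + \<alpha>) / 2"] assms(2) by (auto simp: field_simps)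
  have "summable (\<lambda>i. real i powr - ((1 + \<alpha>) / 2))"
    using assms(2) by (subst summable_real_powr_iff) (simp add: field_simps)
  then have "summable a"
    using i0 assms(1) by (intro summable_comparison_test'[of _ "max 1 i\<^sub>0" a]) (auto simp: less_imp_le)
  then show ?thesis by (subst summable_Suc_iff)
qed

definition long_branches :: "(nat \<Rightarrow> real) \<Rightarrow> real \<Rightarrow> nat \<Rightarrow> nat set"
  where "long_branches a r n = {c. Suc c \<in> {n..2 * n} \<and> r \<le> a (Suc c)}"

lemma finite_long_branches: "finite (long_branches a r n)"
  by (rule finite_subset[of _ "{..2 * n}"]) (auto simp: long_branches_def)

lemma card_long_branches:
  assumes "1 \<le> n"
  shows "card (long_branches a r n) = card {j \<in> {n..2 * n}. r \<le> a j}"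
proof -
  have "Suc ` long_branches a r n = {j \<in> {n..2 * n}. r \<le> a j}"
  proof (intro equalityI subsetI)
    fix j assume j: "j \<in> {j \<in> {n..2 * n}. r \<le> a j}"
    then obtain c where "j = Suc c" using assms by (cases j) auto
    then show "j \<in> Suc ` long_branches a r n" using j by (auto simp: long_branches_def)
  qed (auto simp: long_branches_def)
  then show ?thesis by (metis card_image inj_Suc)
qed

text \<open>No branch in the block can exceed the typical length by much, so the sum over the block can
  only be as large as assumed if many branches have almost the typical length.\<close>

lemma many_long_branches:
  assumes "1 < \<alpha>" and upper: "le_powr_o1 a (- \<alpha>)"
    and blocks: "eq_powr_o1 (\<lambda>i. \<Sum>j=i..2*i. a j) (1 - \<alpha>)" and \<eta>: "0 < \<eta>" "\<eta> < 1"
  shows "\<forall>\<^sub>F n in sequentially.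
    real n powr (1 - \<eta>) \<le> real (card (long_branches a (real n powr - (\<alpha> + \<eta>)) n))"
proof -
  define e where "e = \<eta> / 4"
  have e: "0 < e" "e < \<alpha>" using assms by (auto simp: e_def)
  obtain i\<^sub>0 where i0: "\<And>i. i\<^sub>0 \<le> i \<Longrightarrow> a i \<le> real i powr - (\<alpha> - e)"
    using le_powr_o1E[OF upper, of "\<alpha> - e"] e by auto
  have "\<forall>\<^sub>F n in sequentially. real n powr (1 - \<alpha> - e) \<le> (\<Sum>j=n..2*n. a j)"
    using blocks e(1) unfolding eq_powr_o1_def by (blast intro: eventually_mono)
  moreover have "\<forall>\<^sub>F n in sequentially. 3 \<le> real n powr (\<eta> / 2)"
  proof -
    have "filterlim (\<lambda>n. real n powr (\<eta> / 2)) at_top sequentially" using \<eta> by real_asymp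
    then show ?thesis by (simp add: filterlim_at_top)
  qed
  moreover have "\<forall>\<^sub>F n in sequentially. max 1 i\<^sub>0 \<le> n" by (rule eventually_ge_at_top)
  ultimately show ?thesis
  proof eventually_elim
    fix n assume block: "real n powr (1 - \<alpha> - e) \<le> (\<Sum>j=n..2*n. a j)"
      and large: "3 \<le> real n powr (\<eta> / 2)" and n: "max 1 i\<^sub>0 \<le> n"
    define r where "r = real n powr - (\<alpha> + \<eta>)"
    define S where "S = {j \<in> {n..2 * n}. r \<le> a j}"
    have S: "finite S" "S \<subseteq> {n..2*n}" by (auto simp: S_def)
    have n1: "1 \<le> real n" using n by simp
    have "(\<Sum>j=n..2*n. a j) = (\<Sum>j\<in>S. a j) + (\<Sum>j\<in>{n..2*n} - S. a j)"
      using S by (metis add.commute finite_atLeastAtMost sum.subset_diff)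
    also have "(\<Sum>j\<in>S. a j) \<le> real (card S) * real n powr - (\<alpha> - e)"
    proof (rule sum_bounded_above)
      fix j assume "j \<in> S"
      then have j: "n \<le> j" by (auto simp: S_def)
      then have "a j \<le> real j powr - (\<alpha> - e)" using n by (intro i0) auto
      also have "\<dots> \<le> real n powr - (\<alpha> - e)" using j n e by (intro powr_mono2') auto
      finally show "a j \<le> real n powr - (\<alpha> - e)" .
    qed
    also have "(\<Sum>j\<in>{n..2*n} - S. a j) \<le> real (card ({n..2*n} - S)) * r"
      by (rule sum_bounded_above) (auto simp: S_def)
    also have "\<dots> \<le> (2 * real n) * r"
    proof (rule mult_right_mono)
      have "card ({n..2*n} - S) \<le> card {n..2*n}" by (intro card_mono) auto
      also have "\<dots> \<le> 2 * n" using n by simp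
      finally show "real (card ({n..2*n} - S)) \<le> 2 * real n" by linarith
    qed (simp add: r_def)
    finally have "real n powr (1 - \<alpha> - e) \<le> real (card S) * real n powr - (\<alpha> - e) + 2 * real n * r"
      using block by simp
    then have "real n powr (1 - \<alpha> - e) * real n powr (\<alpha> - e)
        \<le> (real (card S) * real n powr - (\<alpha> - e) + 2 * real n * r) * real n powr (\<alpha> - e)"
      by (rule mult_right_mono) simp
    moreover have "real n powr (1 - \<alpha> - e) * real n powr (\<alpha> - e) = real n powr (1 - \<eta>) * real n powr (\<eta> / 2)"
      by (simp add: powr_add[symmetric] e_def)
    moreover have "real n powr - (\<alpha> - e) * real n powr (\<alpha> - e) = 1"
      using n1 by (simp add: powr_add[symmetric])
    moreover have "real n * r * real n powr (\<alpha> - e) \<le> real n powr (1 - \<eta>)"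
    proof -
      have "real n * r * real n powr (\<alpha> - e) = real n powr 1 * real n powr - (\<alpha> + \<eta>) * real n powr (\<alpha> - e)"
        using n1 by (simp add: r_def)
      also have "\<dots> = real n powr (1 - \<eta> - e)"
        unfolding powr_add[symmetric] by (simp add: algebra_simps)
      also have "\<dots> \<le> real n powr (1 - \<eta>)" using n1 e by (intro powr_mono) auto
      finally show ?thesis .
    qed
    moreover have "real n powr (1 - \<eta>) * 3 \<le> real n powr (1 - \<eta>) * real n powr (\<eta> / 2)"
      using large by (intro mult_left_mono) auto
    ultimately have "real n powr (1 - \<eta>) \<le> real (card S)"
      by (simp add: distrib_right mult.assoc)
    then show "real n powr (1 - \<eta>) \<le> real (card (long_branches a (real n powr - (\<alpha> + \<eta>)) n))"
      using n by (simp add: card_long_branches S_def r_def)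
  qed
qed

section \<open>The Cantor set in the random tree\<close>

context tree_aggregation
begin

text \<open>Whatever the past, each branch hits the given piece of branch \<open>c + 1\<close> with a probability of at
  least its length divided by the total length of the whole tree.\<close>

lemma prob_cell_missed_le:
  assumes a: "\<And>i. 1 \<le> i \<Longrightarrow> 0 < a i" and sum: "summable (\<lambda>c. a (Suc c))"
    and "finite J" and J: "\<And>d. d \<in> J \<Longrightarrow> c < d"
    and I: "0 \<le> p" "p \<le> q" "q \<le> a (Suc c)"
  shows "prob {\<omega> \<in> space M. \<forall>d\<in>J. U d \<omega> \<in> - last_coord_in c {p..q}}
    \<le> exp (- (real (card J) * (q - p) / (\<Sum>c. a (Suc c))))"
proof -
  define A where "A = (\<Sum>c. a (Suc c))"
  have partial: "(\<Sum>b<n. a (Suc b)) \<le> A" for n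
    unfolding A_def using sum a by (intro sum_le_suminf) (auto simp: less_imp_le)
  have "a (Suc c) \<le> (\<Sum>b<Suc c. a (Suc b))"
    using a by (intro member_le_sum) (auto simp: less_imp_le)
  then have "a (Suc c) \<le> A" using partial[of "Suc c"] by simp
  then have A: "0 < A" "q - p \<le> A" using a[of "Suc c"] I by auto
  have in_tree: "AE \<omega> in M. \<forall>n. starts \<omega> n \<in> tree_points_upto lens (starts \<omega>) n"
    by (rule AE_glue_points_in_tree) (rule a)
  have "prob {\<omega> \<in> space M. \<forall>d\<in>J. U d \<omega> \<in> - last_coord_in c {p..q}} \<le> (\<Prod>d\<in>J. 1 - (q - p) / A)"
  proof (rule prob_glue_points_le[OF \<open>finite J\<close>])
    fix d assume "d \<in> J"
    then have "c < d" by (rule J)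
    then show "1 \<le> d" by simp
    show "- last_coord_in c {p..q} \<in> sets borel" by (intro borel_comp) simp
    show "0 \<le> 1 - (q - p) / A" using A by simp
    show "AE \<omega> in M. measure (tree_uniform a (\<lambda>k. U k \<omega>) d) (- last_coord_in c {p..q}) \<le> 1 - (q - p) / A"
      using in_tree
    proof eventually_elim
      case (elim \<omega>)
      then show ?case
        using a \<open>c < d\<close> I partial by (intro measure_tree_uniform_avoid_le) auto
    qed
  qed
  also have "\<dots> = (1 - (q - p) / A) ^ card J" by simp
  also have "\<dots> \<le> exp (- ((q - p) / A)) ^ card J"
    using A exp_ge_add_one_self[of "- ((q - p) / A)"] by (intro power_mono) auto
  also have "\<dots> = exp (- (real (card J) * (q - p) / A))"
    by (simp add: exp_of_nat_mult[symmetric])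
  finally show ?thesis by (simp add: A_def)
qed

text \<open>Generation \<open>k\<close> of the Cantor set uses the long branches \<open>J k\<close> of the block of indices between \<open>N k\<close>
  and \<open>2 N k\<close>, on which there is room for \<open>m k\<close> cells of width \<open>w k\<close>. The next block has about
  \<open>N (k + 1) powr (1 - \<eta>)\<close> long branches, and a cell of width \<open>w k = N (k + 1) powr (2 \<eta> - 1)\<close> expects
  about \<open>N (k + 1) powr \<eta>\<close> of them, so that with probability exponentially close to \<open>1\<close> no cell is missed.
  As there are about \<open>N (k + 1) powr (1 - 2 \<eta>)\<close> cells on each branch of generation \<open>k\<close>, while on branches of
  generation \<open>k + 1\<close> cells take up a length of about \<open>N (k + 1) powr - (\<alpha> + \<eta>)\<close>, the Hoelder condition holds for the exponent
  \<open>s\<close> as soon as \<open>\<kappa> = 1 - 2 \<eta> - s (\<alpha> + \<eta>)\<close> is positive and \<open>N (k + 1)\<close> is large enough to absorb the length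
  of the previous branches. Choosing \<open>N (k + 1)\<close> after \<open>N k\<close>, all such requirements can be met.\<close>

lemma AE_hausdorff_measure_leaves_neq_0:
  assumes a: "\<And>i. 1 \<le> i \<Longrightarrow> 0 < a i" and \<alpha>: "1 < \<alpha>" and upper: "le_powr_o1 a (- \<alpha>)"
    and blocks: "eq_powr_o1 (\<lambda>i. \<Sum>j=i..2*i. a j) (1 - \<alpha>)"
    and s: "0 < s" "s * \<alpha> < 1"
  shows "AE \<omega> in M. \<forall>r. 0 < r \<and> r \<le> s \<longrightarrow> hausdorff_measure (tree_points lens (starts \<omega>))
    (length_dist (tree_points lens (starts \<omega>))) r (leaves (tree_points lens (starts \<omega>))) \<noteq> 0"
proof -
  have "s < 1" using s \<alpha> by (metis less_le_not_le linorder_not_less mult_less_cancel_left1 order.strict_trans)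
  define \<eta> where "\<eta> = (1 - s * \<alpha>) / 4"
  define \<gamma> where "\<gamma> = 1 - 2 * \<eta>"
  define \<kappa> where "\<kappa> = \<gamma> - s * (\<alpha> + \<eta>)"
  have \<eta>: "0 < \<eta>" "\<eta> < 1 / 4" using s \<alpha> by (auto simp: \<eta>_def)
  have "s * \<eta> < 1 * \<eta>" using \<open>s < 1\<close> \<eta> by (intro mult_strict_right_mono) auto
  then have \<kappa>: "0 < \<kappa>" using s by (simp add: \<kappa>_def \<gamma>_def \<eta>_def algebra_simps) (simp add: field_simps)
  have \<gamma>: "1 / 2 < \<gamma>" "\<gamma> < 1" using \<eta> by (auto simp: \<gamma>_def)
  have sum: "summable (\<lambda>c. a (Suc c))" using a \<alpha> upper by (rule summable_le_powr_o1)
  define A where "A = (\<Sum>c. a (Suc c))"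
  have "0 < A" unfolding A_def using sum a by (intro suminf_pos) auto
  have in_tree: "AE \<omega> in M. \<forall>n. starts \<omega> n \<in> tree_points_upto lens (starts \<omega>) n"
    by (rule AE_glue_points_in_tree) (rule a)

  define R where "R n = real n powr - (\<alpha> + \<eta>)" for n :: nat
  define L where "L n = long_branches a (R n) n" for n
  have R: "0 < R n" "R n \<le> 1" if "1 \<le> n" for n
    using that \<alpha> \<eta> powr_mono[of "- (\<alpha> + \<eta>)" 0 "real n"] by (auto simp: R_def)
  define Q where "Q k N n \<longleftrightarrow> 2 * N + 1 < n \<and> 2 \<le> R N * real n powr \<gamma> \<and> 1 \<le> R N * real n powr \<kappa> \<and>
    (real n)\<^sup>2 * exp (- (real n powr \<eta> / (2 * A))) \<le> (1 / 2) ^ k" for k :: nat and N n :: nat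
  define P where "P n \<longleftrightarrow> 2 \<le> n \<and> real n powr (1 - \<eta>) \<le> real (card (L n))" for n :: nat
  have evP: "\<forall>\<^sub>F n in sequentially. P n"
    unfolding P_def L_def R_def using many_long_branches[OF \<alpha> upper blocks, of \<eta>] \<eta>
    by (intro eventually_conj eventually_ge_at_top) auto
  have evQ: "\<forall>\<^sub>F n in sequentially. Q k N n" if "P N" for k N
  proof -
    have RN: "0 < R N" using that by (intro R) (simp add: P_def)
    have big: "\<forall>\<^sub>F n in sequentially. x \<le> R N * real n powr e" if "0 < e" for x e :: real
    proof -
      have "filterlim (\<lambda>n. R N * real n powr e) at_top sequentially" using RN that by real_asymp
      then show ?thesis by (simp add: filterlim_at_top)
    qed
    have "(\<lambda>n. (real n)\<^sup>2 * exp (- (real n powr \<eta> / (2 * A)))) \<longlonglongrightarrow> 0"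
      using \<eta>(1) \<open>0 < A\<close> by real_asymp
    then have "\<forall>\<^sub>F n in sequentially. (real n)\<^sup>2 * exp (- (real n powr \<eta> / (2 * A))) < (1 / 2) ^ k"
      by (rule order_tendstoD) simp
    then show ?thesis
      unfolding Q_def using big[of \<gamma> 2] big[of \<kappa> 1] \<kappa> \<gamma>
      by (intro eventually_conj eventually_gt_at_top) (auto elim: eventually_mono)
  qed
  obtain N where "\<forall>k. P (N k) \<and> Q k (N k) (N (Suc k))"
    using dependent_nat_choice[of "\<lambda>_. P" Q] eventually_happens[OF evP] eventually_happens[OF eventually_conj[OF evP evQ]]
    by auto
  then have N_P: "P (N k)" and N_Q: "Q k (N k) (N (Suc k))" for k by auto
  have N2: "2 \<le> N k" for k using N_P[of k] by (simp add: P_def)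

  define J where "J k = L (N k)" for k
  define w where "w k = real (N (Suc k)) powr - \<gamma>" for k
  define m where "m k = nat \<lfloor>R (N k) / w k\<rfloor>" for k
  have w: "0 < w k" for k using N2[of "Suc k"] by (simp add: w_def)
  have Rk: "0 < R (N k)" "R (N k) \<le> 1" for k using R[of "N k"] N2[of k] by auto
  have ratio: "R (N k) / w k = R (N k) * real (N (Suc k)) powr \<gamma>" for k
    by (simp add: w_def powr_minus field_simps)
  have ratio2: "2 \<le> R (N k) / w k" for k using N_Q[of k] by (simp add: ratio Q_def)
  have m_eq: "real (m k) = of_int \<lfloor>R (N k) / w k\<rfloor>" for k
    unfolding m_def using ratio2[of k] by simp
  have m2: "2 \<le> m k" for k
    using ratio2[of k] unfolding m_def by (simp add: le_nat_iff le_floor_iff)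
  have mw_le: "real (m k) * w k \<le> R (N k)" for k
    using of_int_floor_le[of "R (N k) / w k"] unfolding m_eq pos_le_divide_eq[OF w] .
  have m_ge: "R (N k) / w k / 2 \<le> real (m k)" for k
  proof -
    have "x / 2 \<le> of_int \<lfloor>x\<rfloor>" if "2 \<le> x" for x :: real
      using that by linarith
    then show ?thesis unfolding m_eq using ratio2 .
  qed
  have mw_ge: "R (N k) / 2 \<le> real (m k) * w k" for k
    using m_ge[of k] w[of k] by (simp add: field_simps)
  define I where "I k p = {w k * (real p + 1 / 2)..w k * (real p + 1)}" for k p
  define miss where "miss k c p = {\<omega> \<in> space M. \<forall>d\<in>J (Suc k). U d \<omega> \<in> - last_coord_in c (I k p)}" for k c p
  define F where "F k = (\<Union>c\<in>J k. \<Union>p\<in>{..<m k}. miss k c p)" for k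
  have finJ: "finite (J k)" for k by (simp add: J_def L_def finite_long_branches)
  have later: "c < d" if "c \<in> J k" "d \<in> J (Suc k)" for c d k
    using that N_Q[of k] by (auto simp: J_def L_def long_branches_def Q_def)
  have J_pos: "1 \<le> d" if "d \<in> J (Suc k)" for d k
    using that N2[of "Suc k"] by (auto simp: J_def L_def long_branches_def)
  have miss_sets: "miss k c p \<in> sets M" for k c p
    unfolding miss_def using finJ J_pos by (intro glue_event_measurable) (auto simp: borel_comp I_def)
  have F_sets: "F k \<in> sets M" for k
    unfolding F_def using finJ miss_sets by (intro sets.finite_UN) auto
  have prob_F: "prob (F k) \<le> (1 / 2) ^ k" for k
  proof -
    let ?n = "real (N (Suc k))"
    have n1: "1 \<le> ?n" using N2[of "Suc k"] by simp
    have miss: "prob (miss k c p) \<le> exp (- (?n powr \<eta> / (2 * A)))" if "c \<in> J k" "p < m k" for c p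
    proof -
      have "w k * (real p + 1) \<le> w k * real (m k)" using \<open>p < m k\<close> w[of k] by (intro mult_left_mono) auto
      also have "\<dots> \<le> R (N k)" using mw_le[of k] by (simp add: mult.commute)
      also have "\<dots> \<le> a (Suc c)" using \<open>c \<in> J k\<close> by (simp add: J_def L_def long_branches_def)
      finally have le: "w k * (real p + 1) \<le> a (Suc c)" .
      have "prob (miss k c p) \<le> exp (- (real (card (J (Suc k))) *
          (w k * (real p + 1) - w k * (real p + 1 / 2)) / A))"
        unfolding miss_def I_def A_def
        by (rule prob_cell_missed_le[OF a sum finJ later[OF \<open>c \<in> J k\<close>] _ _ le]) (use w[of k] in auto)
      also have "\<dots> = exp (- (real (card (J (Suc k))) * w k / (2 * A)))"
        by (simp add: algebra_simps)
      also have "\<dots> \<le> exp (- (?n powr \<eta> / (2 * A)))"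
      proof -
        have "?n powr \<eta> = ?n powr (1 - \<eta>) * w k"
          by (simp add: w_def \<gamma>_def powr_add[symmetric])
        also have "\<dots> \<le> real (card (J (Suc k))) * w k"
          using N_P[of "Suc k"] w[of k] by (intro mult_right_mono) (auto simp: P_def J_def)
        finally show ?thesis using \<open>0 < A\<close> by (simp add: divide_right_mono)
      qed
      finally show ?thesis .
    qed
    have "prob (F k) \<le> (\<Sum>c\<in>J k. prob (\<Union>p\<in>{..<m k}. miss k c p))"
      unfolding F_def using finJ miss_sets
      by (intro finite_measure_subadditive_finite) (auto intro!: sets.finite_UN)
    also have "\<dots> \<le> (\<Sum>c\<in>J k. \<Sum>p<m k. prob (miss k c p))"
      using miss_sets by (intro sum_mono finite_measure_subadditive_finite) auto
    also have "\<dots> \<le> (\<Sum>c\<in>J k. \<Sum>p<m k. exp (- (?n powr \<eta> / (2 * A))))"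
      using miss by (intro sum_mono) auto
    also have "\<dots> = real (card (J k)) * real (m k) * exp (- (?n powr \<eta> / (2 * A)))"
      by simp
    also have "\<dots> \<le> ?n * ?n * exp (- (?n powr \<eta> / (2 * A)))"
    proof (intro mult_right_mono mult_mono)
      have "J k \<subseteq> {..<2 * N k}" by (auto simp: J_def L_def long_branches_def)
      then have "card (J k) \<le> 2 * N k" using card_mono[of "{..<2 * N k}" "J k"] by simp
      then show "real (card (J k)) \<le> ?n" using N_Q[of k] by (simp add: Q_def)
      have "real (m k) \<le> R (N k) / w k" unfolding m_eq by simp
      also have "\<dots> \<le> 1 * ?n powr \<gamma>" unfolding ratio using Rk[of k] by (intro mult_right_mono) auto
      also have "\<dots> \<le> ?n" using n1 \<gamma> powr_mono[of \<gamma> 1 ?n] by simp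
      finally show "real (m k) \<le> ?n" .
    qed auto
    also have "\<dots> \<le> (1 / 2) ^ k" using N_Q[of k] by (simp add: Q_def power2_eq_square)
    finally show ?thesis .
  qed
  have "AE \<omega> in M. eventually (\<lambda>k. \<omega> \<in> space M - F k) sequentially"
  proof (rule borel_cantelli_AE1[OF F_sets])
    show "emeasure M (F k) < \<infinity>" for k by (simp add: emeasure_eq_measure)
    show "summable (\<lambda>k. prob (F k))"
      using prob_F by (intro summable_comparison_test'[OF summable_geometric[of "1 / 2 :: real"], of 0]) auto
  qed
  then show ?thesis using in_tree
  proof eventually_elim
    case (elim \<omega>)
    then obtain K where K: "\<And>k. K \<le> k \<Longrightarrow> \<omega> \<in> space M - F k"
      by (auto simp: eventually_sequentially)
    interpret glued_tree lens "starts \<omega>"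
      using elim a by unfold_locales auto
    let ?T = "tree_points lens (starts \<omega>)"
    \<comment> \<open>No cell is missed from generation \<open>K\<close> on, so the construction starts there. The first generation
      has no predecessor to provide many cells; the second summand of \<open>C\<close> makes up for this.\<close>
    define C where "C = 4 + (real (m K) * w K) powr - s"
    have "0 < C" by (simp add: C_def add_pos_nonneg)
    have "0 < real (card (J K))"
    proof (rule less_le_trans)
      show "0 < real (N K) powr (1 - \<eta>)" using N2[of K] by simp
      show "real (N K) powr (1 - \<eta>) \<le> real (card (J K))" using N_P[of K] by (simp add: P_def J_def)
    qed
    then obtain c0 where c0: "c0 \<in> J K" by (metis card.empty equals0I less_irrefl of_nat_0)
    have child: "\<exists>d\<in>J (Suc (K + k)). ell1_nth (starts \<omega> d) c \<in> I (K + k) p"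
      if "c \<in> J (K + k)" "p < m (K + k)" for k c p
    proof -
      have "\<omega> \<notin> miss (K + k) c p" and "\<omega> \<in> space M"
        using K[of "K + k"] that by (auto simp: F_def)
      then obtain d where d: "d \<in> J (Suc (K + k))" "U d \<omega> \<in> last_coord_in c (I (K + k) p)"
        by (auto simp: miss_def)
      then have "ell1_nth (starts \<omega> d) c \<in> I (K + k) p"
        using J_pos[OF d(1)] by (simp add: last_coord_in_def branch_start_def)
      then show ?thesis using d(1) by blast
    qed
    have const: "1 \<le> C * (\<Prod>i<k. real (m (K + i))) * (real (m (K + k)) * w (K + k)) powr s" for k
    proof (cases k)
      case 0
      have "1 = (real (m K) * w K) powr - s * (real (m K) * w K) powr s"
        using w[of K] m2[of K] by (simp add: powr_add[symmetric])
      also have "\<dots> \<le> C * (real (m K) * w K) powr s"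
        unfolding C_def by (intro mult_right_mono) auto
      finally show ?thesis using 0 by simp
    next
      case (Suc j)
      let ?i = "K + j"
      have "1 / 4 \<le> R (N ?i) * real (N (Suc ?i)) powr \<kappa> / 4"
        using N_Q[of ?i] by (simp add: Q_def)
      also have "real (N (Suc ?i)) powr \<kappa> = real (N (Suc ?i)) powr \<gamma> * R (N (Suc ?i)) powr s"
        by (simp add: \<kappa>_def R_def powr_powr powr_add[symmetric] algebra_simps)
      also have "R (N ?i) * (real (N (Suc ?i)) powr \<gamma> * R (N (Suc ?i)) powr s) / 4
        = (R (N ?i) / w ?i / 2) * (R (N (Suc ?i)) powr s / 2)"
        by (simp add: ratio)
      also have "\<dots> \<le> real (m ?i) * (real (m (Suc ?i)) * w (Suc ?i)) powr s"
      proof (intro mult_mono m_ge)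
        have "(2::real) powr s \<le> 2" using \<open>s < 1\<close> powr_mono[of s 1 2] by simp
        then have "R (N (Suc ?i)) powr s / 2 \<le> R (N (Suc ?i)) powr s / 2 powr s"
          by (intro divide_left_mono) auto
        also have "\<dots> = (R (N (Suc ?i)) / 2) powr s"
          using Rk[of "Suc ?i"] by (simp add: powr_divide)
        also have "\<dots> \<le> (real (m (Suc ?i)) * w (Suc ?i)) powr s"
          using mw_ge[of "Suc ?i"] Rk[of "Suc ?i"] s by (intro powr_mono2) auto
        finally show "R (N (Suc ?i)) powr s / 2 \<le> (real (m (Suc ?i)) * w (Suc ?i)) powr s" .
      qed auto
      also have "\<dots> \<le> (\<Prod>i<k. real (m (K + i))) * (real (m (Suc ?i)) * w (Suc ?i)) powr s"
      proof (rule mult_right_mono)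
        have "1 \<le> (\<Prod>i<j. real (m (K + i)))"
        proof (rule prod_ge_1)
          show "1 \<le> real (m (K + i))" for i using m2[of "K + i"] by simp
        qed
        then have "1 * real (m ?i) \<le> (\<Prod>i<j. real (m (K + i))) * real (m ?i)"
          by (rule mult_right_mono) simp
        then show "real (m ?i) \<le> (\<Prod>i<k. real (m (K + i)))" by (simp add: Suc)
      qed simp
      finally have "1 / 4 \<le> (\<Prod>i<k. real (m (K + i))) * (real (m (K + k)) * w (K + k)) powr s"
        by (simp add: Suc)
      then have "4 * (1 / 4) \<le> C * ((\<Prod>i<k. real (m (K + i))) * (real (m (K + k)) * w (K + k)) powr s)"
        unfolding C_def by (intro mult_mono) auto
      then show ?thesis by (simp add: mult.assoc)
    qed
    obtain z where z: "\<And>t. t \<in> {0..<1::real} \<Longrightarrow> z t \<in> leaves ?T"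
      and inv: "\<And>t t'. t \<in> {0..<1} \<Longrightarrow> t' \<in> {0..<1} \<Longrightarrow> \<bar>t - t'\<bar> \<le> 4 * C * dist (z t) (z t') powr s"
    proof (rule cantor_leaves[where J = "\<lambda>k. J (K + k)" and m = "\<lambda>k. m (K + k)"
          and w = "\<lambda>k. w (K + k)" and s = s and C = C])
      show "summable lens" by (rule sum)
      show "c0 \<in> J (K + 0)" using c0 by simp
      show "\<exists>d\<in>J (K + Suc k). ell1_nth (starts \<omega> d) c \<in>
          {w (K + k) * (real p + 1 / 2)..w (K + k) * (real p + 1)}"
        if "c \<in> J (K + k)" "p < m (K + k)" for k c p
        using child[OF that] by (simp add: I_def)
    qed (use w m2 s \<open>s < 1\<close> const that in auto)
    show ?case
    proof (intro allI impI)
      fix r assume r: "0 < r \<and> r \<le> s"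
      show "hausdorff_measure ?T (length_dist ?T) r (leaves ?T) \<noteq> 0"
      proof (rule hausdorff_measure_neq_0[where z = z and C = "4 * C" and s = s])
        show "\<bar>t - t'\<bar> \<le> 4 * C * length_dist ?T (z t) (z t') powr s"
          if "t \<in> {0..<1}" "t' \<in> {0..<1}" for t t'
          using inv[OF that] z[OF that(1)] z[OF that(2)]
          by (simp add: length_dist_tree_points leaves_tree_points)
        show "0 \<le> length_dist ?T x y" for x y by (simp add: length_dist_def)
      qed (use z r \<open>0 < C\<close> in auto)
    qed
  qed
qed

end

section \<open>The dimension of the set of leaves\<close>

lemma hausdorff_dim_eqI:
  assumes "0 < d"
    and zero: "\<And>s. d < s \<Longrightarrow> hausdorff_measure X \<delta> s S = 0"
    and pos: "\<And>s. 0 < s \<Longrightarrow> s < d \<Longrightarrow> hausdorff_measure X \<delta> s S \<noteq> 0"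
  shows "hausdorff_dim X \<delta> S = ereal d"
  unfolding hausdorff_dim_def
proof (rule antisym)
  show "Inf (ereal ` {s. 0 < s \<and> hausdorff_measure X \<delta> s S = 0}) \<le> ereal d"
  proof (rule ereal_le_epsilon2)
    fix e :: real assume "0 < e"
    then have "ereal (d + e) \<in> ereal ` {s. 0 < s \<and> hausdorff_measure X \<delta> s S = 0}"
      using zero[of "d + e"] \<open>0 < d\<close> by auto
    then show "Inf (ereal ` {s. 0 < s \<and> hausdorff_measure X \<delta> s S = 0}) \<le> ereal d + ereal e"
      by (intro Inf_lower) simp
  qed
  show "ereal d \<le> Inf (ereal ` {s. 0 < s \<and> hausdorff_measure X \<delta> s S = 0})"
    using pos by (intro Inf_greatest) (force simp: not_less[symmetric])
qed

text \<open>The almost sure statements hold for fixed exponents; letting \<open>\<theta> m\<close> increase to \<open>1\<close> along a sequence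
  gives them for all exponents simultaneously.\<close>

theorem theorem2:
  fixes a :: "nat \<Rightarrow> real" and \<alpha> :: real
    and M :: "'w measure" and U :: "nat \<Rightarrow> 'w \<Rightarrow> ell1"
  assumes a_pos: "\<And>i. i \<ge> 1 \<Longrightarrow> a i > 0"
    and aggregation: "tree_aggregation M a U"
    and alpha: "\<alpha> > 1"
    and a_upper: "le_powr_o1 a (- \<alpha>)"
    and a_blocks: "eq_powr_o1 (\<lambda>i. \<Sum>j=i..2*i. a j) (1 - \<alpha>)"
  shows "AE \<omega> in M.
    (let T = limit_tree a (\<lambda>n. U n \<omega>)
     in hausdorff_dim T (length_dist T) (leaves T) = ereal (1 / \<alpha>))"
proof -
  interpret tree_aggregation M a U by (rule aggregation)
  let ?T = "\<lambda>\<omega>. tree_points (\<lambda>c. a (Suc c)) (branch_start (\<lambda>k. U k \<omega>))"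
  let ?H = "\<lambda>\<omega> s. hausdorff_measure (?T \<omega>) (length_dist (?T \<omega>)) s (leaves (?T \<omega>))"
  define \<theta> where "\<theta> m = 1 - 1 / real (m + 2)" for m :: nat
  have \<theta>: "0 < \<theta> m" "\<theta> m < 1" for m by (auto simp: \<theta>_def field_simps)
  have "\<theta> \<longlonglongrightarrow> 1" unfolding \<theta>_def by real_asymp
  have "AE \<omega> in M. \<forall>m. \<forall>s>0. 1 < (1 + \<theta> m * (\<alpha> - 1)) * s \<longrightarrow> ?H \<omega> s = 0"
    unfolding AE_all_countable
  proof
    fix m
    have "\<theta> m * (\<alpha> - 1) < 1 * (\<alpha> - 1)" using \<theta>[of m] alpha by (intro mult_strict_right_mono) auto
    then have "1 + \<theta> m * (\<alpha> - 1) < \<alpha>" by simp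
    then obtain i0 where "\<And>i. i0 \<le> i \<Longrightarrow> a i \<le> real i powr - (1 + \<theta> m * (\<alpha> - 1))"
      using le_powr_o1E[OF a_upper] by blast
    then show "AE \<omega> in M. \<forall>s>0. 1 < (1 + \<theta> m * (\<alpha> - 1)) * s \<longrightarrow> ?H \<omega> s = 0"
      using a_pos \<theta>[of m] alpha by (intro AE_hausdorff_measure_leaves_eq_0) auto
  qed
  moreover have "AE \<omega> in M. \<forall>m. \<forall>s. 0 < s \<and> s \<le> \<theta> m / \<alpha> \<longrightarrow> ?H \<omega> s \<noteq> 0"
    unfolding AE_all_countable
  proof
    fix m
    show "AE \<omega> in M. \<forall>s. 0 < s \<and> s \<le> \<theta> m / \<alpha> \<longrightarrow> ?H \<omega> s \<noteq> 0"
      using a_pos \<theta>[of m] alpha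
      by (intro AE_hausdorff_measure_leaves_neq_0[OF _ alpha a_upper a_blocks]) auto
  qed
  moreover have "AE \<omega> in M. limit_tree a (\<lambda>n. U n \<omega>) = ?T \<omega>"
    using AE_glue_points_in_tree a_pos
    by (auto intro!: limit_tree_eq_tree_points elim!: eventually_mono)
  ultimately show ?thesis
  proof eventually_elim
    case (elim \<omega>)
    have "hausdorff_dim (?T \<omega>) (length_dist (?T \<omega>)) (leaves (?T \<omega>)) = ereal (1 / \<alpha>)"
    proof (rule hausdorff_dim_eqI)
      show "0 < 1 / \<alpha>" using alpha by simp
    next
      fix s assume s: "1 / \<alpha> < s"
      then have "0 < s" using alpha by (meson divide_pos_pos less_trans zero_less_one)
      have "(\<lambda>m. (1 + \<theta> m * (\<alpha> - 1)) * s) \<longlonglongrightarrow> (1 + 1 * (\<alpha> - 1)) * s"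
        using \<open>\<theta> \<longlonglongrightarrow> 1\<close> by (intro tendsto_intros)
      moreover have "1 < (1 + 1 * (\<alpha> - 1)) * s" using s alpha by (simp add: field_simps)
      ultimately have "\<forall>\<^sub>F m in sequentially. 1 < (1 + \<theta> m * (\<alpha> - 1)) * s"
        by (rule order_tendstoD)
      then obtain m where "1 < (1 + \<theta> m * (\<alpha> - 1)) * s"
        by (auto dest: eventually_happens)
      then show "?H \<omega> s = 0" using elim \<open>0 < s\<close> by blast
    next
      fix s assume s: "0 < s" "s < 1 / \<alpha>"
      have "(\<lambda>m. \<theta> m / \<alpha>) \<longlonglongrightarrow> 1 / \<alpha>"
        using \<open>\<theta> \<longlonglongrightarrow> 1\<close> alpha by (intro tendsto_intros) auto
      then have "\<forall>\<^sub>F m in sequentially. s < \<theta> m / \<alpha>" using s(2) by (rule order_tendstoD)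
      then obtain m where "s < \<theta> m / \<alpha>" by (auto dest: eventually_happens)
      then show "?H \<omega> s \<noteq> 0" using elim(2) s(1) less_imp_le by blast
    qed
    then show ?case using elim by (simp add: Let_def)
  qed
qed

end
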